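(* Let $G=\mathbb{R}^n$ be a stratified nilpotent Lie group of rank $r$, identified with $\mathbb{R}^n$ via exponential coordinates of the second type, and let $\gamma:[0,1]\to G$ be a horizontal curve with $\gamma(0)=0$. Let $P_i^v$ ($i\le n$, $v\in\mathbb{R}^n$) be the extremal polynomials associated with an adapted basis of $\mathrm{Prol}(\mathfrak g)$, $\mathfrak g=\mathrm{Lie}(G)$. Then the following statements are equivalent: (A) The curve $\gamma$ is an abnormal extremal. (B) There exists $v\in\mathbb{R}^n$, $v\neq0$, such that $P_i^v(\gamma(t))=0$ for all $t\in[0,1]$ and for all $i\in\mathbb{Z}$ with $i\le r$.
   Context: Stratified group. $G$ is a (connected, simply connected) nilpotent Lie group of dimension $n$ whose real Lie algebra of left-invariant vector fields is stratified: $\mathfrak g=\mathfrak g_1\oplus\cdots\oplus\mathfrak g_s$, $\mathfrak g_i=[\mathfrak g_{i-1},\mathfrak g_1]$ for $i=2,\dots,s$, $\mathfrak g_i=\{0\}$ for $i>s$; $s$ is the step and $r=\dim\mathfrak g_1$ the rank. Tanaka prolongation. $\mathfrak g_0$ is the space of linear maps $\phi:\mathfrak g\to\mathfrak g$ with $\phi(\mathfrak g_i)\subset\mathfrak g_i$ for $i=1,\dots,s$ and $\phi([X,Y])=[\phi(X),Y]+[X,\phi(Y)]$ for all $X,Y\in\mathfrak g$. Set $[\phi,X]=-[X,\phi]=\phi(X)$ for $\phi\in\mathfrak g_0$, $X\in\mathfrak g$. Inductively for $k\ge1$, when $\mathfrak g_{1-k},\dots,\mathfrak g_s$ and the brackets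 $[\phi,X]=\phi(X)$ with $X\in\mathfrak g$ are already defined, $\mathfrak g_{-k}$ is the space of linear maps $\phi:\mathfrak g\to\mathfrak g_{1-k}\oplus\cdots\oplus\mathfrak g_{s-k}$ with $\phi(\mathfrak g_i)\subset\mathfrak g_{i-k}$ for $i=1,\dots,s$ and $\phi([X,Y])=[\phi(X),Y]+[X,\phi(Y)]$ for all $X,Y\in\mathfrak g$; again $[\phi,X]=-[X,\phi]=\phi(X)$ for $X\in\mathfrak g$. For $\phi,\psi$ of degree $\le 0$ the bracket is defined inductively by $[\phi,\psi](X)=[[\phi,X],\psi]+[\phi,[\psi,X]]$, $X\in\mathfrak g$. Then $\mathrm{Prol}(\mathfrak g)=\bigoplus_{k\le s}\mathfrak g_k$ is a graded Lie algebra ($[\mathfrak g_i,\mathfrak g_j]\subset\mathfrak g_{i+j}$) with finite-dimensional strata, possibly infinite dimensional. Basis and degrees. $X_1,\dots,X_n$ is a basis of $\mathfrak g$ adapted to the stratification, extended to a basis $\{X_j\}_{j\le n}$ of $\mathrm{Prol}(\mathfrak g)$ indexed by integers $j\le n$ (if $\mathrm{Prol}(\mathfrak g)$ is finite dimensional, by $m\le j\le n$ for some $m\in\mathbb{Z}$; the notation $j\le n$ is still used and always refers to indices in the range). Each $X_j$ lies in some stratum $\mathfrak g_k$; its degree is $d(j)=k$. The basis is adapted: $i<j$ implies $d(i)\le d(j)$; so $X_1,\dots,X_r$ is a basis of $\mathfrak g_1$. Structure constants: $[X_i,X_j]=\sum_{k\le n}c_{ij}^kX_k$ (a finite sum). Coordinates.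 $G$ is identified with $\mathbb{R}^n$ by $x=(x_1,\dots,x_n)\leftrightarrow \exp(x_nX_n)\cdot\ldots\cdot\exp(x_1X_1)$, and $X_1,\dots,X_n$ are viewed as left-invariant vector fields on $\mathbb{R}^n$. Generalized structure constants. For $\alpha\in\mathbb{N}^n=\{0,1,2,\dots\}^n$ and $i\le n$, $[X_i,X_\alpha]$ denotes the left-nested iterated bracket in which, starting from $X_i$, one brackets on the right $\alpha_1$ times with $X_1$, then $\alpha_2$ times with $X_2$, ..., finally $\alpha_n$ times with $X_n$; $[X_i,X_0]=X_i$. The constants $c_{i\alpha}^k$ are defined by $[X_i,X_\alpha]=\sum_{k\le n}c_{i\alpha}^kX_k$. Extremal polynomials. For $v=(v_1,\dots,v_n)\in\mathbb{R}^n$, with the convention $v_k=0$ for $k\le0$, and for $i\le n$, $$P_i^v(x)=\sum_{\alpha\in\mathbb{N}^n}\frac{(-1)^{|\alpha|}}{\alpha!}\Big(\sum_{k\le n}c_{i\alpha}^kv_k\Big)x^\alpha,\qquad x\in\mathbb{R}^n,$$ where $|\alpha|=\alpha_1+\cdots+\alpha_n$, $\alpha!=\alpha_1!\cdots\alpha_n!$ (only finitely many terms are nonzero). Horizontal curves. A Lipschitz curve $\gamma:[0,1]\to G=\mathbb{R}^n$ is horizontal if there is $h=(h_1,\dots,h_r)\in L^\infty([0,1];\mathbb{R}^r)$ (the controls) with $\dot\gamma=\sum_{j=1}^rh_jX_j(\gamma)$ a.e. on $[0,1]$; then $h_j=\dot\gamma_j$ for $j=1,\dots,r$. Abnormal extremals.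 A horizontal curve $\gamma:[0,1]\to G$ is an abnormal extremal if there exist Lipschitz functions $\lambda_1,\dots,\lambda_n:[0,1]\to\mathbb{R}$ (coordinates of a dual curve $\lambda=\sum_i\lambda_i\vartheta_i$ in $\mathfrak g^*$, with $\vartheta_1,\dots,\vartheta_n$ the dual basis of $X_1,\dots,X_n$) such that: $(\lambda_1(t),\dots,\lambda_n(t))\ne0$ for every $t\in[0,1]$; $\lambda_1=\dots=\lambda_r=0$ on $[0,1]$; and for all $i=1,\dots,n$, $\dot\lambda_i=-\sum_{k=1}^n\sum_{j=1}^rc_{ij}^k\dot\gamma_j\lambda_k$ a.e. on $[0,1]$. *)

theory Defs
  imports "HOL-Analysis.Analysis" "HOL-Library.Function_Algebras"
begin

instantiation "fun" :: (type, real_vector) real_vector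
begin

definition scaleR_fun_def: "scaleR c f = (\<lambda>x. c *\<^sub>R f x)"

instance
  by standard (simp_all add: scaleR_fun_def plus_fun_def scaleR_add_right scaleR_add_left)

end

section \<open>Stratified Lie algebras\<close>

definition lie_algebra :: "('g::real_vector \<Rightarrow> 'g \<Rightarrow> 'g) \<Rightarrow> bool" where
  "lie_algebra br \<longleftrightarrow>
     (\<forall>x. linear (\<lambda>y. br x y)) \<and> (\<forall>y. linear (\<lambda>x. br x y)) \<and>
     (\<forall>x. br x x = 0) \<and>
     (\<forall>x y z. br x (br y z) + br y (br z x) + br z (br x y) = 0)"

text \<open>\<open>V i\<close> is the layer of degree \<open>i\<close>; only its values at \<open>i \<ge> 1\<close> matter. The generation
  condition is imposed for every \<open>i \<ge> 2\<close>, so that \<open>[V s, V 1] = 0\<close> is included.\<close>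

definition stratified_lie_algebra ::
    "('g::real_vector \<Rightarrow> 'g \<Rightarrow> 'g) \<Rightarrow> (int \<Rightarrow> 'g set) \<Rightarrow> int \<Rightarrow> bool" where
  "stratified_lie_algebra br V s \<longleftrightarrow>
     lie_algebra br \<and> s \<ge> 1 \<and>
     (\<forall>i\<ge>1. subspace (V i)) \<and>
     (\<forall>x. \<exists>!f. (\<forall>i\<in>{1..s}. f i \<in> V i) \<and> (\<forall>i. i \<notin> {1..s} \<longrightarrow> f i = 0) \<and> x = (\<Sum>i=1..s. f i)) \<and>
     (\<forall>i\<ge>2. V i = span {br x y |x y. x \<in> V (i - 1) \<and> y \<in> V 1}) \<and>
     V s \<noteq> {0} \<and> (\<forall>i>s. V i = {0})"

section \<open>Tanaka prolongation\<close>

text \<open>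
  The spaces of the prolongation are nested spaces of linear maps, so they are realised inside
  one ambient real vector space. Writing \<open>U\<close> for the type \<open>'g tower\<close>, currying gives
  \<open>U \<cong> 'g \<times> ('g \<Rightarrow> U)\<close> via \<open>F \<mapsto> (g_part F, act F)\<close>.

  A map \<open>\<phi> : \<gg> \<rightarrow> U\<close> of degree \<open>\<le> 0\<close> is the element \<open>F\<close> with \<open>g_part F = 0\<close> and
  \<open>act F = \<phi>\<close>. An element \<open>X\<close> of \<open>\<gg>\<close> is the element \<open>embed br X\<close>, whose \<open>g_part\<close> is \<open>X\<close> and
  whose \<open>act\<close> is \<open>Y \<mapsto> [X, Y]\<close>. In both cases \<open>act F Y\<close> is the bracket \<open>[F, Y]\<close> in the
  prolongation, and \<open>- act F Y\<close> is \<open>[Y, F]\<close>. Brackets of two elements of degree \<open>\<le> 0\<close>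
  do not enter the extremal polynomials and are not defined here.
\<close>

type_synonym 'g tower = "'g list \<Rightarrow> 'g"

definition g_part :: "'g tower \<Rightarrow> 'g" where
  "g_part F = F []"

definition act :: "'g tower \<Rightarrow> 'g \<Rightarrow> 'g tower" where
  "act F Y = (\<lambda>Ys. F (Y # Ys))"

definition embed :: "('g \<Rightarrow> 'g \<Rightarrow> 'g) \<Rightarrow> 'g \<Rightarrow> 'g tower" where
  "embed br X = (\<lambda>Ys. foldl br X Ys)"

lemma g_part_embed: "g_part (embed br X) = X"
  by (simp add: g_part_def embed_def)

lemma act_embed: "act (embed br X) Y = embed br (br X Y)"
  by (simp add: act_def embed_def)

lemma tower_eqI: "g_part F = g_part G \<Longrightarrow> act F = act G \<Longrightarrow> F = G"
proof (rule ext)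
  fix Ys
  assume "g_part F = g_part G" "act F = act G"
  then show "F Ys = G Ys"
    by (cases Ys) (auto simp: g_part_def act_def dest!: fun_cong)
qed

text \<open>In rule \<open>neg\<close> the last premise is \<open>\<phi>[X,Y] = [\<phi>(X),Y] + [X,\<phi>(Y)]\<close>. Distinct strata are
  independent inside \<open>U\<close>, so the span in \<open>prolongation\<close> is the direct sum of the strata.\<close>

inductive stratum :: "('g::real_vector \<Rightarrow> 'g \<Rightarrow> 'g) \<Rightarrow> (int \<Rightarrow> 'g set) \<Rightarrow> int \<Rightarrow> 'g tower \<Rightarrow> bool"
  for br V where
  pos: "k \<ge> 1 \<Longrightarrow> X \<in> V k \<Longrightarrow> stratum br V k (embed br X)"
| neg: "k \<le> 0 \<Longrightarrow> g_part F = 0 \<Longrightarrow> linear (act F) \<Longrightarrow>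
        (\<forall>i\<ge>1. \<forall>X\<in>V i. stratum br V (i + k) (act F X)) \<Longrightarrow>
        (\<forall>X Y. act F (br X Y) = act (act F X) Y - act (act F Y) X) \<Longrightarrow>
        stratum br V k F"

definition prolongation :: "('g::real_vector \<Rightarrow> 'g \<Rightarrow> 'g) \<Rightarrow> (int \<Rightarrow> 'g set) \<Rightarrow> 'g tower set" where
  "prolongation br V = span {F. \<exists>k. stratum br V k F}"

text \<open>\<open>J\<close> is the index range of the basis \<open>X\<close> and \<open>d\<close> its degree function.\<close>

definition adapted_basis ::
    "('g::real_vector \<Rightarrow> 'g \<Rightarrow> 'g) \<Rightarrow> (int \<Rightarrow> 'g set) \<Rightarrow> int \<Rightarrow> int set \<Rightarrow>
     (int \<Rightarrow> 'g tower) \<Rightarrow> (int \<Rightarrow> int) \<Rightarrow> bool" where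
  "adapted_basis br V n J X d \<longleftrightarrow>
     (J = {..n} \<or> (\<exists>m. J = {m..n})) \<and> {1..n} \<subseteq> J \<and>
     inj_on X J \<and> independent (X ` J) \<and>
     span (X ` J) = prolongation br V \<and>
     span (X ` {1..n}) = range (embed br) \<and>
     (\<forall>j\<in>J. stratum br V (d j) (X j)) \<and>
     (\<forall>i\<in>J. \<forall>j\<in>J. i < j \<longrightarrow> d i \<le> d j)"

section \<open>Lie groups on a vector space\<close>

primrec C_k :: "nat \<Rightarrow> ('a::real_normed_vector \<Rightarrow> 'b::real_normed_vector) \<Rightarrow> bool" where
  "C_k 0 f \<longleftrightarrow> continuous_on UNIV f"
| "C_k (Suc k) f \<longleftrightarrow>
     (\<forall>x. f differentiable (at x)) \<and> (\<forall>v. C_k k (\<lambda>x. frechet_derivative f (at x) v))"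

definition smooth :: "('a::euclidean_space \<Rightarrow> 'b::euclidean_space) \<Rightarrow> bool" where
  "smooth f \<longleftrightarrow> (\<forall>k. C_k k f)"

definition lie_group :: "('a::euclidean_space \<Rightarrow> 'a \<Rightarrow> 'a) \<Rightarrow> bool" where
  "lie_group mul \<longleftrightarrow>
     smooth (\<lambda>(x, y). mul x y) \<and> (\<exists>iv. group mul 0 iv \<and> smooth iv)"

text \<open>The Lie algebra of left-invariant vector fields is identified with the tangent space at
  the identity \<open>0\<close>; \<open>left_inv mul u\<close> is the left-invariant field with value \<open>u\<close> there.\<close>

definition left_inv :: "('a::real_normed_vector \<Rightarrow> 'a \<Rightarrow> 'a) \<Rightarrow> 'a \<Rightarrow> 'a \<Rightarrow> 'a" where
  "left_inv mul u p = frechet_derivative (mul p) (at 0) u"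

text \<open>Commutator of vector fields, \<open>[U,W] f = U (W f) - W (U f)\<close>.\<close>

definition vf_bracket ::
    "('a::real_normed_vector \<Rightarrow> 'a) \<Rightarrow> ('a \<Rightarrow> 'a) \<Rightarrow> 'a \<Rightarrow> 'a" where
  "vf_bracket U W p = frechet_derivative W (at p) (U p) - frechet_derivative U (at p) (W p)"

definition lie_bracket :: "('a::real_normed_vector \<Rightarrow> 'a \<Rightarrow> 'a) \<Rightarrow> 'a \<Rightarrow> 'a \<Rightarrow> 'a" where
  "lie_bracket mul u w = vf_bracket (left_inv mul u) (left_inv mul w) 0"

text \<open>\<open>t \<mapsto> E (t u)\<close> is the integral curve through the identity of the left-invariant field
  of \<open>u\<close>. This determines \<open>E\<close> uniquely.\<close>

definition exponential_map :: "('a::real_normed_vector \<Rightarrow> 'a \<Rightarrow> 'a) \<Rightarrow> ('a \<Rightarrow> 'a) \<Rightarrow> bool" where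
  "exponential_map mul E \<longleftrightarrow>
     E 0 = 0 \<and>
     (\<forall>u t. ((\<lambda>t. E (t *\<^sub>R u)) has_vector_derivative left_inv mul u (E (t *\<^sub>R u))) (at t))"

text \<open>Throughout, \<open>ix\<close> is a bijection from \<open>{1..n}\<close> onto the index type \<open>'n\<close>, so that \<open>x $ ix k\<close>
  is the coordinate \<open>x\<^sub>k\<close>. The group has already been transported to \<open>\<real>\<^sup>n\<close> along the
  coordinates, so the point with coordinates \<open>x\<close> is \<open>x\<close> itself:
  \<open>x = exp (x\<^sub>n X\<^sub>n) \<cdot> \<dots> \<cdot> exp (x\<^sub>1 X\<^sub>1)\<close>.\<close>

definition second_type_coordinates ::
    "(real^'n \<Rightarrow> real^'n \<Rightarrow> real^'n) \<Rightarrow> (int \<Rightarrow> 'n) \<Rightarrow> (int \<Rightarrow> (real^'n) tower) \<Rightarrow> bool" where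
  "second_type_coordinates mul ix X \<longleftrightarrow>
     (\<exists>E. exponential_map mul E \<and>
        (\<forall>x. x = foldr mul (map (\<lambda>k. E ((x $ ix k) *\<^sub>R g_part (X k))) (rev [1..int CARD('n)])) 0))"

section \<open>Extremal polynomials\<close>

text \<open>Meaningful for \<open>1 \<le> j \<le> n\<close> only, where \<open>X j\<close> lies in the embedded Lie algebra.\<close>

definition structure_const ::
    "int set \<Rightarrow> (int \<Rightarrow> ('g::real_vector) tower) \<Rightarrow> int \<Rightarrow> int \<Rightarrow> int \<Rightarrow> real" where
  "structure_const J X i j k = representation (X ` J) (act (X i) (g_part (X j))) (X k)"

text \<open>Multi-indices are functions on \<open>'n\<close>; the exponent \<open>\<alpha>\<^sub>k\<close> is \<open>\<alpha> (ix k)\<close>.\<close>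

definition iterated_bracket ::
    "(int \<Rightarrow> 'n::finite) \<Rightarrow> (int \<Rightarrow> 'g tower) \<Rightarrow> int \<Rightarrow> ('n \<Rightarrow> nat) \<Rightarrow> 'g tower" where
  "iterated_bracket ix X i \<alpha> =
     foldl act (X i) (concat (map (\<lambda>j. replicate (\<alpha> (ix j)) (g_part (X j))) [1..int CARD('n)]))"

definition gen_structure_const ::
    "(int \<Rightarrow> 'n::finite) \<Rightarrow> int set \<Rightarrow> (int \<Rightarrow> ('g::real_vector) tower) \<Rightarrow> int \<Rightarrow> ('n \<Rightarrow> nat) \<Rightarrow> int \<Rightarrow> real"
  where
  "gen_structure_const ix J X i \<alpha> k = representation (X ` J) (iterated_bracket ix X i \<alpha>) (X k)"

text \<open>The inner sum runs over \<open>1 \<le> k \<le> n\<close> because \<open>v\<^sub>k = 0\<close> for \<open>k \<le> 0\<close> by convention. Only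
  finitely many multi-indices contribute to the outer sum.\<close>

definition extremal_poly ::
    "(int \<Rightarrow> 'n::finite) \<Rightarrow> int set \<Rightarrow> (int \<Rightarrow> ('g::real_vector) tower) \<Rightarrow> int \<Rightarrow>
     real^'n \<Rightarrow> real^'n \<Rightarrow> real" where
  "extremal_poly ix J X i v x =
     (\<Sum>\<^sub>\<infinity>\<alpha>::'n \<Rightarrow> nat.
        (-1) ^ (\<Sum>j\<in>UNIV. \<alpha> j) / (\<Prod>j\<in>UNIV. fact (\<alpha> j)) *
        (\<Sum>k=1..int CARD('n). gen_structure_const ix J X i \<alpha> k * v $ ix k) *
        (\<Prod>j\<in>UNIV. (x $ j) ^ \<alpha> j))"

section \<open>Horizontal curves and abnormal extremals\<close>

definition horizontal_curve ::
    "(real^'n \<Rightarrow> real^'n \<Rightarrow> real^'n) \<Rightarrow> (int \<Rightarrow> (real^'n) tower) \<Rightarrow> int \<Rightarrow> (real \<Rightarrow> real^'n) \<Rightarrow> bool"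
  where
  "horizontal_curve mul X r \<gamma> \<longleftrightarrow>
     (\<exists>L. L-lipschitz_on {0..1} \<gamma>) \<and>
     (\<exists>h::int \<Rightarrow> real \<Rightarrow> real.
        (\<forall>j\<in>{1..r}. h j \<in> borel_measurable (lebesgue_on {0..1}) \<and>
           (\<exists>C. AE t in lebesgue_on {0..1}. \<bar>h j t\<bar> \<le> C)) \<and>
        (AE t in lebesgue_on {0..1}.
           (\<gamma> has_vector_derivative (\<Sum>j=1..r. h j t *\<^sub>R left_inv mul (g_part (X j)) (\<gamma> t)))
             (at t within {0..1})))"

text \<open>\<open>l i\<close> is the coordinate \<open>\<lambda>\<^sub>i\<close> of the dual curve.\<close>

definition abnormal_extremal ::
    "(real^'n \<Rightarrow> real^'n \<Rightarrow> real^'n) \<Rightarrow> (int \<Rightarrow> 'n) \<Rightarrow> int set \<Rightarrow> (int \<Rightarrow> (real^'n) tower) \<Rightarrow> int \<Rightarrow>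
     (real \<Rightarrow> real^'n) \<Rightarrow> bool" where
  "abnormal_extremal mul ix J X r \<gamma> \<longleftrightarrow>
     horizontal_curve mul X r \<gamma> \<and>
     (\<exists>l::int \<Rightarrow> real \<Rightarrow> real.
        (\<forall>i\<in>{1..int CARD('n)}. \<exists>L. L-lipschitz_on {0..1} (l i)) \<and>
        (\<forall>t\<in>{0..1}. \<exists>i\<in>{1..int CARD('n)}. l i t \<noteq> 0) \<and>
        (\<forall>i\<in>{1..r}. \<forall>t\<in>{0..1}. l i t = 0) \<and>
        (\<forall>i\<in>{1..int CARD('n)}. AE t in lebesgue_on {0..1}.
           (l i has_real_derivative
              - (\<Sum>k=1..int CARD('n). \<Sum>j=1..r.
                   structure_const J X i j k *
                   (vector_derivative \<gamma> (at t within {0..1}) $ ix j) * l k t))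
             (at t within {0..1})))"

end

theory Submission
  imports Defs
begin

text \<open>
  Write \<open>R\<^sub>j F = [F, X\<^sub>j]\<close>. The sum defining \<open>P\<^sub>i\<^sup>v(x)\<close> factors as the product of the flows
  \<open>exp (- x\<^sub>n R\<^sub>n) \<dots> exp (- x\<^sub>1 R\<^sub>1)\<close> applied to \<open>X\<^sub>i\<close> and paired with \<open>v\<close>, that is, as
  \<open>\<langle>v, Ad(x) X\<^sub>i\<rangle>\<close> with \<open>Ad\<close> extended to the prolongation. Commuting the flows past each
  other shows that the derivative of this function along the left-invariant field of \<open>u\<close> is
  \<open>- \<langle>v, Ad(x) [X\<^sub>i, u]\<rangle>\<close>, so the functions \<open>P\<^sub>i\<^sup>v \<circ> \<gamma>\<close> with \<open>1 \<le> i \<le> n\<close> solve the adjoint equation.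
  Conversely, a dual curve satisfies \<open>\<lambda>(t) = \<lambda>(0) \<circ> Ad(\<gamma>(t))\<close>, hence
  \<open>\<lambda>\<^sub>i = P\<^sub>i\<^sup>v \<circ> \<gamma>\<close> for \<open>v = \<lambda>(0)\<close>. For \<open>i \<le> 0\<close> the same derivative formula makes \<open>P\<^sub>i\<^sup>v \<circ> \<gamma>\<close>
  constant by descending induction on the degree, and \<open>P\<^sub>i\<^sup>v(0) = 0\<close>.
\<close>

section \<open>Calculus\<close>

text \<open>The group is not made to act on elements of nonpositive degree. The operators
  \<open>tower_prod\<close> take the place of such an action, and what ties them to the group is
  their commutation with \<open>act\<close>, which involves only the adjoint action on the Lie
  algebra itself. The inverse action \<open>Adi\<close> is the natural one: when a coordinate x_k
  varies in exp(x_n X_n) ... exp(x_1 X_1), the factors of smaller index stand to its right, and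
  carrying the variation past them conjugates by their inverse.

  The cut-off N comes from the grading. A bracket with the Lie algebra raises the degree by at least
  one, so an element of degree k vanishes on words longer than s - k; an infinite-dimensional
  prolongation raises no question of convergence.

  Curves are only Lipschitz and equations hold almost everywhere. The dual curve is therefore
  recovered from a conserved pairing rather than from uniqueness for the adjoint equation. This step
  and the vanishing in degree \<le> 0 rest on one fact: a differentiable function whose derivative
  along a Lipschitz curve is zero almost everywhere is constant on it.\<close>

lemma mixed_difference_mean_value:
  fixes f :: "'a::real_normed_vector \<Rightarrow> real"
  assumes f: "\<And>z. (f has_derivative f' z) (at z)"
    and f1: "\<And>z. ((\<lambda>z. f' z v) has_derivative f'' z) (at z)"
    and h: "h > 0"
  shows "\<exists>\<xi> \<eta>. 0 < \<xi> \<and> \<xi> < h \<and> 0 < \<eta> \<and> \<eta> < h \<and>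
    f (z + h *\<^sub>R v + h *\<^sub>R w) - f (z + h *\<^sub>R v) - f (z + h *\<^sub>R w) + f z
      = h * h * f'' (z + \<xi> *\<^sub>R v + \<eta> *\<^sub>R w) w"
proof -
  \<comment> \<open>The mean value theorem is applied to the \<open>w\<close>-increment along
    \<open>v\<close>, and again to the resulting derivative along \<open>w\<close>; this order
    decides which mixed derivative appears.\<close>
  define \<phi> where "\<phi> s = f (z + s *\<^sub>R v + h *\<^sub>R w) - f (z + s *\<^sub>R v)" for s
  have lf: "f' z (c *\<^sub>R x) = c * f' z x" for z c x
    using has_derivative_bounded_linear[OF f] by (simp add: bounded_linear.linear linear_scale)
  have lf1: "f'' z (c *\<^sub>R x) = c * f'' z x" for z c x
    using has_derivative_bounded_linear[OF f1] by (simp add: bounded_linear.linear linear_scale)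
  have "(\<phi> has_derivative (\<lambda>c. f' (z + s *\<^sub>R v + h *\<^sub>R w) (c *\<^sub>R v) - f' (z + s *\<^sub>R v) (c *\<^sub>R v))) (at s)" for s
    unfolding \<phi>_def by (rule derivative_eq_intros has_derivative_compose[OF _ f] | simp)+
  then have \<phi>: "(\<phi> has_real_derivative (f' (z + s *\<^sub>R v + h *\<^sub>R w) v - f' (z + s *\<^sub>R v) v)) (at s)" for s
    unfolding has_field_derivative_def by (rule has_derivative_eq_rhs) (simp add: fun_eq_iff lf algebra_simps)
  obtain \<xi> where \<xi>: "0 < \<xi>" "\<xi> < h"
    "\<phi> h - \<phi> 0 = (h - 0) * (f' (z + \<xi> *\<^sub>R v + h *\<^sub>R w) v - f' (z + \<xi> *\<^sub>R v) v)"
    using MVT2[OF h \<phi>] by blast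
  define \<psi> where "\<psi> t = f' (z + \<xi> *\<^sub>R v + t *\<^sub>R w) v" for t
  have "(\<psi> has_derivative (\<lambda>c. f'' (z + \<xi> *\<^sub>R v + t *\<^sub>R w) (c *\<^sub>R w))) (at t)" for t
    unfolding \<psi>_def by (rule derivative_eq_intros has_derivative_compose[OF _ f1] | simp)+
  then have \<psi>: "(\<psi> has_real_derivative f'' (z + \<xi> *\<^sub>R v + t *\<^sub>R w) w) (at t)" for t
    unfolding has_field_derivative_def by (rule has_derivative_eq_rhs) (simp add: fun_eq_iff lf1 mult.commute)
  obtain \<eta> where \<eta>: "0 < \<eta>" "\<eta> < h"
    "\<psi> h - \<psi> 0 = (h - 0) * f'' (z + \<xi> *\<^sub>R v + \<eta> *\<^sub>R w) w"
    using MVT2[OF h \<psi>] by blast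
  show ?thesis
    using \<xi> \<eta> by (intro exI[of _ \<xi>] exI[of _ \<eta>]) (simp add: \<phi>_def \<psi>_def)
qed

text \<open>The second difference over a small parallelogram is symmetric in its two edges, so it
  equals \<open>h * h\<close> times either mixed derivative at nearby points; continuity at
  \<open>z\<close> lets the parallelogram shrink.\<close>

lemma second_derivative_symmetric_real:
  fixes f :: "'a::real_normed_vector \<Rightarrow> real"
  assumes f: "\<And>z. (f has_derivative f' z) (at z)"
    and fv: "\<And>z. ((\<lambda>z. f' z v) has_derivative fv z) (at z)"
    and fw: "\<And>z. ((\<lambda>z. f' z w) has_derivative fw z) (at z)"
    and cv: "isCont (\<lambda>z. fv z w) z" and cw: "isCont (\<lambda>z. fw z v) z"
  shows "fv z w = fw z v"
proof -
  have "\<exists>a b. dist a z \<le> h * (norm v + norm w) \<and> dist b z \<le> h * (norm v + norm w) \<and> fv a w = fw b v"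
    if h: "h > 0" for h
  proof -
    have small: "dist (z + \<xi> *\<^sub>R x + \<eta> *\<^sub>R y) z \<le> h * (norm x + norm y)"
      if "0 < \<xi>" "\<xi> < h" "0 < \<eta>" "\<eta> < h" for \<xi> \<eta> x y
    proof -
      have "dist (z + \<xi> *\<^sub>R x + \<eta> *\<^sub>R y) z \<le> norm (\<xi> *\<^sub>R x) + norm (\<eta> *\<^sub>R y)"
        by (simp only: dist_norm add.assoc add_diff_cancel_left' norm_triangle_ineq)
      also have "\<dots> \<le> h * norm x + h * norm y"
        using that by (intro add_mono) (simp_all add: mult_right_mono)
      finally show ?thesis by (simp add: distrib_left)
    qed
    obtain \<xi> \<eta> where 1: "0 < \<xi>" "\<xi> < h" "0 < \<eta>" "\<eta> < h"
      "f (z + h *\<^sub>R v + h *\<^sub>R w) - f (z + h *\<^sub>R v) - f (z + h *\<^sub>R w) + f z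
      = h * h * fv (z + \<xi> *\<^sub>R v + \<eta> *\<^sub>R w) w"
      using mixed_difference_mean_value[OF f fv h] by blast
    obtain \<xi>' \<eta>' where 2: "0 < \<xi>'" "\<xi>' < h" "0 < \<eta>'" "\<eta>' < h"
      "f (z + h *\<^sub>R w + h *\<^sub>R v) - f (z + h *\<^sub>R w) - f (z + h *\<^sub>R v) + f z
      = h * h * fw (z + \<xi>' *\<^sub>R w + \<eta>' *\<^sub>R v) v"
      using mixed_difference_mean_value[OF f fw h] by blast
    have "h * h * fv (z + \<xi> *\<^sub>R v + \<eta> *\<^sub>R w) w = h * h * fw (z + \<xi>' *\<^sub>R w + \<eta>' *\<^sub>R v) v"
      using 1(5) 2(5) by (simp add: algebra_simps)
    then have "fv (z + \<xi> *\<^sub>R v + \<eta> *\<^sub>R w) w = fw (z + \<xi>' *\<^sub>R w + \<eta>' *\<^sub>R v) v"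
      using h by simp
    moreover have "dist (z + \<xi>' *\<^sub>R w + \<eta>' *\<^sub>R v) z \<le> h * (norm v + norm w)"
      using small[OF 2(1-4), of w v] by (simp add: add.commute)
    ultimately show ?thesis
      using small[OF 1(1-4), of v w] by blast
  qed
  then have "\<forall>n. \<exists>a b. dist a z \<le> inverse (real (Suc n)) * (norm v + norm w) \<and>
      dist b z \<le> inverse (real (Suc n)) * (norm v + norm w) \<and> fv a w = fw b v"
    by simp
  then obtain a b where ab: "\<And>n. dist (a n) z \<le> inverse (real (Suc n)) * (norm v + norm w)"
      "\<And>n. dist (b n) z \<le> inverse (real (Suc n)) * (norm v + norm w)" "\<And>n. fv (a n) w = fw (b n) v"
    by metis
  have lim: "(\<lambda>n. inverse (real (Suc n)) * (norm v + norm w)) \<longlonglongrightarrow> 0"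
    using tendsto_mult_left_zero[OF LIMSEQ_inverse_real_of_nat] by simp
  have "a \<longlonglongrightarrow> z" "b \<longlonglongrightarrow> z"
    unfolding tendsto_dist_iff[of _ z]
    by (rule real_tendsto_sandwich[OF _ _ tendsto_const lim], use ab(1,2) in \<open>simp_all del: of_nat_Suc\<close>)+
  then have "(\<lambda>n. fv (a n) w) \<longlonglongrightarrow> fv z w" "(\<lambda>n. fw (b n) v) \<longlonglongrightarrow> fw z v"
    using isCont_tendsto_compose[OF cv] isCont_tendsto_compose[OF cw] by blast+
  then show ?thesis
    using ab(3) LIMSEQ_unique by simp
qed

lemma second_derivative_symmetric:
  fixes f :: "'a::real_normed_vector \<Rightarrow> 'b::euclidean_space"
  assumes f: "\<And>z. (f has_derivative f' z) (at z)"
    and fv: "\<And>z. ((\<lambda>z. f' z v) has_derivative fv z) (at z)"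
    and fw: "\<And>z. ((\<lambda>z. f' z w) has_derivative fw z) (at z)"
    and cv: "isCont (\<lambda>z. fv z w) z" and cw: "isCont (\<lambda>z. fw z v) z"
  shows "fv z w = fw z v"
proof (rule euclidean_eqI)
  fix b :: 'b
  show "fv z w \<bullet> b = fw z v \<bullet> b"
    by (rule second_derivative_symmetric_real[where f = "\<lambda>z. f z \<bullet> b"])
      (use assms in \<open>auto intro!: has_derivative_inner_left isCont_inner simp del: inner_commute\<close>)
qed

section \<open>Null sets of values and constancy along Lipschitz curves\<close>

lemma negligible_image_derivative_zero:
  fixes f :: "real \<Rightarrow> real"
  assumes "\<And>t. t \<in> S \<Longrightarrow> (f has_derivative (\<lambda>_. 0)) (at t within S)"
  shows "negligible ((\<lambda>t. (vec (f t) :: real^1)) ` S)"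
proof -
  define S' where "S' = (vec ` S :: (real^1) set)"
  have S': "(\<lambda>x. x $ 1) ` S' = S"
    unfolding S'_def by (auto simp: image_image)
  have "negligible ((\<lambda>x::real^1. (vec (f (x $ 1)) :: real^1)) ` S')"
  \<comment> \<open>The zero derivative has a matrix of rank below 1 everywhere. Domain and values
    sit in \<open>real^1\<close> because Sard's theorem is stated for maps between coordinate
    spaces.\<close>
  proof (rule baby_Sard[where f' = "\<lambda>_ _. 0"])
    fix x assume x: "x \<in> S'"
    have v: "bounded_linear (vec :: real \<Rightarrow> real^1)"
      by (simp add: linear_conv_bounded_linear[symmetric] linear_vec)
    have "((\<lambda>x::real^1. f (x $ 1)) has_derivative (\<lambda>_. 0)) (at x within S')"
      by (rule has_derivative_in_compose[where f = "\<lambda>x::real^1. x $ 1" and g = f and g' = "\<lambda>_. 0"])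
        (use x assms S' in \<open>auto intro!: derivative_intros bounded_linear_imp_has_derivative bounded_linear_vec_nth\<close>)
    from bounded_linear.has_derivative[OF v this]
    show "((\<lambda>x::real^1. (vec (f (x $ 1)) :: real^1)) has_derivative (\<lambda>_. 0)) (at x within S')"
      by (simp add: zero_vec_def vec_def)
  qed (auto simp: matrix_def zero_vec_def[symmetric] less_rank_noninjective)
  then show ?thesis
    by (simp add: S'_def image_image)
qed

lemma AE_lebesgue_on_iff_negligible:
  assumes "S \<in> sets lebesgue"
  shows "(AE t in lebesgue_on S. P t) \<longleftrightarrow> negligible {t \<in> S. \<not> P t}"
proof -
  have "(AE t in lebesgue_on S. P t) \<longleftrightarrow> (AE t in lebesgue. t \<in> S \<longrightarrow> P t)"
    using assms by (subst AE_restrict_space_iff) (auto simp: sets.sets_into_space)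
  also have "\<dots> \<longleftrightarrow> {t \<in> S. \<not> P t} \<in> null_sets lebesgue"
    unfolding completion.AE_iff_null_sets by simp
  finally show ?thesis
    by (simp add: negligible_iff_null_sets)
qed

text \<open>The exceptional set is mapped to a null set because the curve is Lipschitz, the rest by Sard's
  theorem; an interval of values of measure zero is a point.\<close>

lemma constant_along_lipschitz_curve:
  fixes \<Gamma> :: "real \<Rightarrow> 'a::euclidean_space" and G :: "'a \<Rightarrow> real"
  assumes lip: "L-lipschitz_on {0..1} \<Gamma>"
    and G: "\<And>t. t \<in> {0..1} \<Longrightarrow> G differentiable (at (\<Gamma> t))"
    and ae: "AE t in lebesgue_on {0..1}. ((\<lambda>t. G (\<Gamma> t)) has_real_derivative 0) (at t within {0..1})"
    and t: "t \<in> {0..1}"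
  shows "G (\<Gamma> t) = G (\<Gamma> 0)"
proof (rule ccontr)
  assume neq: "G (\<Gamma> t) \<noteq> G (\<Gamma> 0)"
  define f where "f = (\<lambda>t. G (\<Gamma> t))"
  define N where "N = {t \<in> {0..1}. \<not> (f has_real_derivative 0) (at t within {0..1})}"
  have N: "negligible N"
    using ae by (subst (asm) AE_lebesgue_on_iff_negligible) (auto simp: N_def f_def)
  \<comment> \<open>\<open>G\<close> is differentiable only at points of the curve, so
    \<open>f\<close> has a Lipschitz bound at each \<open>x\<close> with a constant depending on
    \<open>x\<close>; this suffices to send null sets to null sets.\<close>
  have "negligible ((\<lambda>t. (vec (f t) :: real^1)) ` N)"
  proof (rule negligible_locally_Lipschitz_image[OF _ N])
    fix x assume "x \<in> N"
    then have x: "x \<in> {0..1}" by (simp add: N_def)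
    obtain G' where G': "(G has_derivative G') (at (\<Gamma> x))"
      using G[OF x] by (auto simp: differentiable_def)
    obtain B where B: "\<And>y. norm (G' y) \<le> norm y * B"
      using bounded_linear.bounded[OF has_derivative_bounded_linear[OF G']] by blast
    obtain \<delta> where \<delta>: "\<delta> > 0" "\<And>y. norm (y - \<Gamma> x) < \<delta> \<Longrightarrow> norm (G y - G (\<Gamma> x) - G' (y - \<Gamma> x)) \<le> 1 * norm (y - \<Gamma> x)"
      using G' unfolding has_derivative_at_alt by (meson zero_less_one)
    have L: "norm (\<Gamma> y - \<Gamma> x) \<le> L * norm (y - x)" if "y \<in> {0..1}" for y
      using lipschitz_onD[OF lip that x] by (simp add: dist_norm)
    \<comment> \<open>The added 1 covers \<open>L = 0\<close>. Within this radius the curve stays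
      where the linearisation of \<open>G\<close> at \<open>\<Gamma> x\<close> has error at most the
      distance.\<close>
    define \<epsilon> where "\<epsilon> = \<delta> / (\<bar>L\<bar> + 1)"
    have \<epsilon>: "\<epsilon> > 0" using \<delta> by (simp add: \<epsilon>_def)
    have "norm ((vec (f y) :: real^1) - vec (f x)) \<le> ((\<bar>B\<bar> + 1) * L) * norm (y - x)" if y: "y \<in> N \<inter> ball x \<epsilon>" for y
    proof -
      have y01: "y \<in> {0..1}" using y by (simp add: N_def)
      have "norm (\<Gamma> y - \<Gamma> x) \<le> (\<bar>L\<bar> + 1) * norm (y - x)"
        by (rule order_trans[OF L[OF y01]]) (simp add: mult_right_mono)
      also have "\<dots> < (\<bar>L\<bar> + 1) * \<epsilon>"
        using y by (intro mult_strict_left_mono) (auto simp: dist_norm norm_minus_commute)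
      also have "\<dots> = \<delta>" by (simp add: \<epsilon>_def)
      finally have "norm (G (\<Gamma> y) - G (\<Gamma> x) - G' (\<Gamma> y - \<Gamma> x)) \<le> norm (\<Gamma> y - \<Gamma> x)"
        using \<delta>(2) by simp
      moreover have "norm (G' (\<Gamma> y - \<Gamma> x)) \<le> \<bar>B\<bar> * norm (\<Gamma> y - \<Gamma> x)"
        by (rule order_trans[OF B]) (simp add: mult.commute mult_right_mono)
      ultimately have "norm (G (\<Gamma> y) - G (\<Gamma> x)) \<le> (\<bar>B\<bar> + 1) * norm (\<Gamma> y - \<Gamma> x)"
        by (simp add: algebra_simps)
      also have "\<dots> \<le> (\<bar>B\<bar> + 1) * (L * norm (y - x))"
        by (intro mult_left_mono L y01) simp
      finally have "norm (f y - f x) \<le> ((\<bar>B\<bar> + 1) * L) * norm (y - x)"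
        by (simp add: f_def)
      moreover have "(vec (f y) :: real^1) - vec (f x) = vec (f y - f x)" by (simp add: vec_eq_iff)
      ultimately show ?thesis by (simp only: norm_vector_1 vec_component)
    qed
    then show "\<exists>T B. open T \<and> x \<in> T \<and>
        (\<forall>y\<in>N \<inter> T. norm ((vec (f y) :: real^1) - vec (f x)) \<le> B * norm (y - x))"
      using \<epsilon> by (intro exI[of _ "ball x \<epsilon>"] exI[of _ "(\<bar>B\<bar> + 1) * L"]) auto
  qed simp
  moreover have "negligible ((\<lambda>t. (vec (f t) :: real^1)) ` ({0..1} - N))"
  proof (rule negligible_image_derivative_zero)
    fix t assume "t \<in> {0..1} - N"
    then have "(f has_derivative (\<lambda>_. 0)) (at t within {0..1})"
      by (auto simp: N_def has_field_derivative_def lambda_zero)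
    then show "(f has_derivative (\<lambda>_. 0)) (at t within {0..1} - N)"
      by (rule has_derivative_subset) simp
  qed
  ultimately have "negligible ((\<lambda>t. (vec (f t) :: real^1)) ` N \<union> (\<lambda>t. vec (f t)) ` ({0..1} - N))"
    by (rule negligible_Un)
  then have neg: "negligible ((\<lambda>t. (vec (f t) :: real^1)) ` {0..1})"
    by (rule negligible_subset) (auto simp: N_def)
  have cont: "continuous_on {0..1} f"
    unfolding f_def
  proof (rule continuous_on_compose2[OF _ lipschitz_on_continuous_on[OF lip] subset_refl])
    show "continuous_on (\<Gamma> ` {0..1}) G"
      using G by (intro continuous_at_imp_continuous_on ballI)
        (metis differentiable_imp_continuous_within imageE)
  qed
  have conn: "connected (f ` {0..1})"
    by (rule connected_continuous_image[OF cont]) simp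
  define a where "a = min (f 0) (f t)"
  define b where "b = max (f 0) (f t)"
  have ab: "a < b" using neq by (auto simp: a_def b_def f_def)
  have "{a..b} \<subseteq> f ` {0..1}"
    using conn t by (intro connected_contains_Icc) (auto simp: a_def b_def min_def max_def)
  then have "cbox (vec a) (vec b) \<subseteq> (\<lambda>t. (vec (f t) :: real^1)) ` {0..1}"
  proof (intro subsetI)
    fix y :: "real^1" assume sub: "{a..b} \<subseteq> f ` {0..1}" and "y \<in> cbox (vec a) (vec b)"
    then have "y $ 1 \<in> {a..b}" by (simp add: mem_box_cart)
    with sub obtain u where "u \<in> {0..1}" "y $ 1 = f u" by blast
    then show "y \<in> (\<lambda>t. vec (f t)) ` {0..1}"
      by (intro image_eqI[of _ _ u]) (simp_all add: vec_eq_iff)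
  qed
  then have "negligible (cbox (vec a :: real^1) (vec b))"
    using neg negligible_subset by blast
  then have "box (vec a :: real^1) (vec b) = {}"
    by (simp add: negligible_interval)
  moreover have "vec ((a + b) / 2) \<in> box (vec a :: real^1) (vec b)"
    using ab by (simp add: mem_box_cart)
  ultimately show False by blast
qed

section \<open>The inverse adjoint action of a Lie group\<close>

lemma smooth_has_derivative: "smooth f \<Longrightarrow> (f has_derivative frechet_derivative f (at z)) (at z)"
  unfolding smooth_def by (metis C_k.simps(2) frechet_derivative_works)

lemma smooth_frechet_derivative: "smooth f \<Longrightarrow> smooth (\<lambda>x. frechet_derivative f (at x) v)"
  unfolding smooth_def by (metis C_k.simps(2))

lemma smooth_isCont: "smooth f \<Longrightarrow> isCont f z"
  unfolding smooth_def by (metis C_k.simps(1) continuous_on_eq_continuous_at open_UNIV UNIV_I)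

lemma frechet_derivative_smooth_symmetric:
  assumes "smooth f"
  shows "frechet_derivative (\<lambda>z. frechet_derivative f (at z) v) (at z) w
       = frechet_derivative (\<lambda>z. frechet_derivative f (at z) w) (at z) v"
  using assms
  by (intro second_derivative_symmetric[where f = f and f' = "\<lambda>z. frechet_derivative f (at z)"
        and fv = "\<lambda>z. frechet_derivative (\<lambda>z. frechet_derivative f (at z) v) (at z)"
        and fw = "\<lambda>z. frechet_derivative (\<lambda>z. frechet_derivative f (at z) w) (at z)"]
      smooth_has_derivative smooth_isCont smooth_frechet_derivative)

locale smooth_group =
  fixes mul :: "'a::euclidean_space \<Rightarrow> 'a \<Rightarrow> 'a" and iv :: "'a \<Rightarrow> 'a"
  assumes smooth_mul: "smooth (\<lambda>(x, y). mul x y)"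
    and grp: "group mul 0 iv"
    and smooth_iv: "smooth iv"
begin

sublocale group mul 0 iv by (rule grp)

lemmas mul_simps [simp] = left_neutral right_neutral left_inverse right_inverse

definition dmul :: "'a \<Rightarrow> 'a \<Rightarrow> 'a \<times> 'a \<Rightarrow> 'a" where
  "dmul p q = frechet_derivative (\<lambda>(x, y). mul x y) (at (p, q))"

lemma mul_has_derivative:
  assumes "(a has_derivative a') (at x within S)" "(b has_derivative b') (at x within S)"
  shows "((\<lambda>x. mul (a x) (b x)) has_derivative (\<lambda>h. dmul (a x) (b x) (a' h, b' h))) (at x within S)"
  using has_derivative_compose[OF has_derivative_Pair[OF assms] smooth_has_derivative[OF smooth_mul]]
  by (simp add: dmul_def)

lemma linear_dmul: "linear (dmul p q)"
  unfolding dmul_def using smooth_has_derivative[OF smooth_mul]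
  by (intro bounded_linear.linear has_derivative_bounded_linear)

lemma mul_left_has_derivative: "((\<lambda>q. mul p q) has_derivative (\<lambda>u. dmul p q (0, u))) (at q)"
  by (rule mul_has_derivative has_derivative_const has_derivative_ident)+

lemma mul_right_has_derivative: "((\<lambda>p. mul p q) has_derivative (\<lambda>u. dmul p q (u, 0))) (at p)"
  by (rule mul_has_derivative has_derivative_const has_derivative_ident)+

lemma left_inv_eq: "left_inv mul u p = dmul p 0 (0, u)"
  unfolding left_inv_def using frechet_derivative_at[OF mul_left_has_derivative] by metis

lemma left_inv_zero [simp]: "left_inv mul u 0 = u"
proof -
  have "mul 0 = (\<lambda>q. q)" by auto
  then show ?thesis
    using frechet_derivative_at[OF has_derivative_ident] by (metis left_inv_def)
qed

lemma linear_left_inv: "linear (\<lambda>u. left_inv mul u p)"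
  unfolding left_inv_eq using has_derivative_linear[OF mul_left_has_derivative] .

text \<open>Left invariance of the fields: associativity gives two expressions for one derivative at
  the identity.\<close>

lemma dmul_left_inv: "dmul a p (0, left_inv mul u p) = left_inv mul u (mul a p)"
proof -
  have "((\<lambda>q. mul a (mul p q)) has_derivative (\<lambda>u. dmul a p (0, left_inv mul u p))) (at 0)"
    using mul_has_derivative[OF has_derivative_const[of a] mul_left_has_derivative[of p 0]]
    by (simp add: left_inv_eq)
  moreover have "((\<lambda>q. mul a (mul p q)) has_derivative (\<lambda>u. left_inv mul u (mul a p))) (at 0)"
    using mul_left_has_derivative[of "mul a p" 0] by (simp add: left_inv_eq assoc)
  ultimately show ?thesis
    using has_derivative_unique by metis
qed

lemma left_inv_inj: "left_inv mul u p = left_inv mul w p \<Longrightarrow> u = w"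
  using dmul_left_inv[of "iv p" p] by (metis left_inverse left_inv_zero)

text \<open>\<open>Adi b\<close> is the adjoint action of \<open>b\<^sup>-\<^sup>1\<close>.\<close>

definition Adi :: "'a \<Rightarrow> 'a \<Rightarrow> 'a" where
  "Adi b u = dmul (iv b) b (0, dmul 0 b (u, 0))"

lemma conjugation_has_derivative: "((\<lambda>q. mul (iv b) (mul q b)) has_derivative Adi b) (at 0)"
  using mul_has_derivative[OF has_derivative_const[of "iv b"] mul_right_has_derivative[of b 0]]
  by (simp add: Adi_def[abs_def])

lemma linear_Adi: "linear (Adi b)"
  using has_derivative_linear[OF conjugation_has_derivative] .

lemma Adi_zero [simp]: "Adi 0 u = u"
proof -
  have "iv 0 = 0" by (metis left_inverse right_neutral)
  then have "((\<lambda>q::'a. q) has_derivative Adi 0) (at 0)"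
    using conjugation_has_derivative[of 0] by simp
  then show ?thesis
    using has_derivative_unique[OF _ has_derivative_ident] by metis
qed

text \<open>The inverse in the conjugation reverses the order of the factors.\<close>

lemma Adi_mul: "Adi (mul a b) u = Adi b (Adi a u)"
proof -
  have inv: "iv (mul a b) = mul (iv b) (iv a)"
    by (rule inverse_distrib_swap)
  have "((\<lambda>q. mul (iv b) (mul (mul (iv a) (mul q a)) b)) has_derivative (\<lambda>u. Adi b (Adi a u))) (at 0)"
    by (rule has_derivative_compose[OF conjugation_has_derivative])
      (simp add: conjugation_has_derivative)
  moreover have "((\<lambda>q. mul (iv b) (mul (mul (iv a) (mul q a)) b)) has_derivative Adi (mul a b)) (at 0)"
    using conjugation_has_derivative[of "mul a b"] by (simp add: inv assoc)
  ultimately show ?thesis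
    using has_derivative_unique by metis
qed

text \<open>From \<open>q b = b (b^-1 q b)\<close>: the right-invariant field of \<open>u\<close>
  agrees at \<open>b\<close> with the left-invariant field of \<open>Adi b u\<close>.\<close>

lemma left_inv_Adi: "left_inv mul (Adi b u) b = dmul 0 b (u, 0)"
proof -
  have "((\<lambda>q. mul b (mul (iv b) (mul q b))) has_derivative (\<lambda>u. dmul b 0 (0, Adi b u))) (at 0)"
    using mul_has_derivative[OF has_derivative_const[of b] conjugation_has_derivative[of b]]
    by simp
  moreover have "((\<lambda>q. mul b (mul (iv b) (mul q b))) has_derivative (\<lambda>u. dmul 0 b (u, 0))) (at 0)"
    using mul_right_has_derivative[of b 0] by (simp add: assoc[symmetric])
  ultimately show ?thesis
    using has_derivative_unique by (metis left_inv_eq)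
qed

text \<open>Smoothness controls derivatives in a fixed direction; a direction that moves with the
  point is expanded in \<open>Basis\<close>.\<close>

lemma dmul_differentiable:
  assumes "a differentiable (at x)" "b differentiable (at x)" "c differentiable (at x)"
    "e differentiable (at x)"
  shows "(\<lambda>x. dmul (a x) (b x) (c x, e x)) differentiable (at x)"
proof -
  have eq: "dmul (a x) (b x) (c x, e x) =
      (\<Sum>i\<in>Basis. ((c x, e x) \<bullet> i) *\<^sub>R dmul (a x) (b x) i)" for x
    using linear_sum[OF linear_dmul[of "a x" "b x"], of "\<lambda>i. ((c x, e x) \<bullet> i) *\<^sub>R i" Basis]
    by (simp only: euclidean_representation linear_scale[OF linear_dmul])
  have "(\<lambda>z. frechet_derivative (\<lambda>(x, y). mul x y) (at z) i) differentiable (at (a x, b x))" for i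
    using smooth_has_derivative[OF smooth_frechet_derivative[OF smooth_mul]] differentiableI by blast
  then have "(\<lambda>x. dmul (a x) (b x) i) differentiable (at x)" for i
    unfolding dmul_def
    by (rule differentiable_compose[where g = "\<lambda>x. (a x, b x)"]) (intro differentiable_Pair assms)
  moreover have "(\<lambda>x. (c x, e x) \<bullet> i) differentiable (at x)" for i
    by (intro differentiable_inner differentiable_Pair assms differentiable_const)
  ultimately show ?thesis
    unfolding eq by (intro differentiable_sum differentiable_scaleR finite_Basis ballI)
qed

lemma Adi_differentiable: "(\<lambda>b. Adi b u) differentiable (at b)"
  unfolding Adi_def
  by (intro dmul_differentiable differentiable_const differentiable_ident
      differentiableI[OF smooth_has_derivative[OF smooth_iv]])

text \<open>Differentiate \<open>left_inv mul (Adi b u) b = dmul 0 b (u, 0)\<close> at \<open>b = 0\<close>; the right-hand side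
  is the right-invariant field of \<open>u\<close>, whose derivative becomes that of a left-invariant field
  after exchanging the order of differentiation.\<close>

lemma Adi_has_derivative_zero: "((\<lambda>b. Adi b u) has_derivative (\<lambda>y. - lie_bracket mul y u)) (at 0)"
proof -
  obtain A where A: "((\<lambda>b. Adi b u) has_derivative A) (at 0)"
    using Adi_differentiable by (auto simp: differentiable_def)
  \<comment> \<open>The second derivative of the multiplication at the identity. Vectors
    \<open>(u, 0)\<close> vary the left factor, vectors \<open>(0, u)\<close> the right one.\<close>
  define D2 where "D2 v w = frechet_derivative (\<lambda>z. frechet_derivative (\<lambda>(x, y). mul x y) (at z) v) (at 0) w"
    for v w :: "'a \<times> 'a"
  have D2: "((\<lambda>z. dmul (fst z) (snd z) v) has_derivative D2 v) (at 0)" for v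
    unfolding D2_def dmul_def
    using smooth_has_derivative[OF smooth_frechet_derivative[OF smooth_mul]] by simp
  have left: "((\<lambda>b. left_inv mul w b) has_derivative (\<lambda>y. D2 (0, w) (y, 0))) (at 0)" for w
    unfolding left_inv_eq
    using has_derivative_compose[OF has_derivative_Pair[OF has_derivative_ident has_derivative_const[of 0]],
      of "\<lambda>z. dmul (fst z) (snd z) (0, w)" "D2 (0, w)" 0 UNIV] D2[of "(0, w)"]
    by (simp add: zero_prod_def)
  have right: "((\<lambda>b. dmul 0 b (w, 0)) has_derivative (\<lambda>y. D2 (w, 0) (0, y))) (at 0)" for w
    using has_derivative_compose[OF has_derivative_Pair[OF has_derivative_const[of 0] has_derivative_ident],
      of "\<lambda>z. dmul (fst z) (snd z) (w, 0)" "D2 (w, 0)" 0 UNIV] D2[of "(w, 0)"]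
    by (simp add: zero_prod_def)
  have bracket: "lie_bracket mul y w = D2 (0, w) (y, 0) - D2 (0, y) (w, 0)" for y w
    using fun_cong[OF frechet_derivative_at[OF left[of w]], of y]
      fun_cong[OF frechet_derivative_at[OF left[of y]], of w]
    by (simp add: lie_bracket_def vf_bracket_def)
  \<comment> \<open>The direction \<open>Adi b u\<close> moves with \<open>b\<close>, so the product
    rule is applied to fields with fixed directions and moving coefficients.\<close>
  have expand: "left_inv mul w b = (\<Sum>i\<in>Basis. (w \<bullet> i) *\<^sub>R left_inv mul i b)" for w b
    using linear_sum[OF linear_left_inv[of b], of "\<lambda>i. (w \<bullet> i) *\<^sub>R i" Basis]
    by (simp only: euclidean_representation linear_scale[OF linear_left_inv])
  have expand': "D2 (0, w) (y, 0) = (\<Sum>i\<in>Basis. (w \<bullet> i) *\<^sub>R D2 (0, i) (y, 0))" for w y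
  proof -
    have "((\<lambda>b. left_inv mul w b) has_derivative (\<lambda>y. \<Sum>i\<in>Basis. (w \<bullet> i) *\<^sub>R D2 (0, i) (y, 0))) (at 0)"
      by (subst expand) (intro has_derivative_sum has_derivative_scaleR_right left)
    from fun_cong[OF has_derivative_unique[OF left this]] show ?thesis .
  qed
  have "((\<lambda>b. \<Sum>i\<in>Basis. (Adi b u \<bullet> i) *\<^sub>R left_inv mul i b) has_derivative
      (\<lambda>y. \<Sum>i\<in>Basis. (Adi 0 u \<bullet> i) *\<^sub>R D2 (0, i) (y, 0) + (A y \<bullet> i) *\<^sub>R left_inv mul i 0)) (at 0)"
    by (intro has_derivative_sum has_derivative_scaleR has_derivative_inner_left A left)
  then have "((\<lambda>b. dmul 0 b (u, 0)) has_derivative (\<lambda>y. D2 (0, u) (y, 0) + A y)) (at 0)"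
    by (simp add: expand[symmetric] left_inv_Adi sum.distrib expand'[symmetric] euclidean_representation)
  then have "D2 (0, u) (y, 0) + A y = D2 (u, 0) (0, y)" for y
    using has_derivative_unique[OF right] by metis
  moreover have "D2 (u, 0) (0, y) = D2 (0, y) (u, 0)" for y
    unfolding D2_def by (rule frechet_derivative_smooth_symmetric[OF smooth_mul])
  ultimately have "A y = - lie_bracket mul y u" for y
    unfolding bracket by (simp add: algebra_simps)
  then show ?thesis
    using A by presburger
qed

text \<open>By \<open>Adi_mul\<close>, translating from \<open>x\<close> to the identity replaces
  \<open>w\<close> by \<open>Adi x w\<close>, and the derivative at the identity is known.\<close>

lemma Adi_derivative_left_inv:
  assumes A: "((\<lambda>b. Adi b w) has_derivative A) (at x)"
  shows "A (left_inv mul u x) = - lie_bracket mul u (Adi x w)"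
proof -
  have "((\<lambda>q. Adi (mul x q) w) has_derivative (\<lambda>u. A (left_inv mul u x))) (at 0)"
    using has_derivative_compose[OF mul_left_has_derivative[of x 0], of "\<lambda>b. Adi b w" A] A
    by (simp add: left_inv_eq)
  then have "((\<lambda>q. Adi q (Adi x w)) has_derivative (\<lambda>u. A (left_inv mul u x))) (at 0)"
    by (simp add: Adi_mul)
  then show ?thesis
    using has_derivative_unique[OF _ Adi_has_derivative_zero] by metis
qed

lemma Adi_along_curve:
  assumes c: "(c has_vector_derivative left_inv mul u (c t)) (at t within S)"
  shows "((\<lambda>t. Adi (c t) w) has_vector_derivative - lie_bracket mul u (Adi (c t) w)) (at t within S)"
proof -
  obtain A where A: "((\<lambda>b. Adi b w) has_derivative A) (at (c t))"
    using Adi_differentiable by (auto simp: differentiable_def)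
  show ?thesis
    using vector_derivative_diff_chain_within[OF c has_derivative_at_withinI[OF A]]
    by (simp add: o_def Adi_derivative_left_inv[OF A])
qed

text \<open>Since \<open>p q b = (p b) (b^-1 q b)\<close>, the factor on the right is passed at the
  price of a conjugation. This serves to vary one factor in the middle of the product that defines
  the coordinates.\<close>

lemma translate_has_vector_derivative:
  assumes c: "(c has_vector_derivative left_inv mul u (c t)) (at t)"
  shows "((\<lambda>t. mul a (mul (c t) b)) has_vector_derivative
    left_inv mul (Adi b u) (mul a (mul (c t) b))) (at t)"
proof -
  let ?f = "\<lambda>p. mul a (mul p b)"
  obtain F where F: "(?f has_derivative F) (at (c t))"
    using mul_has_derivative[OF has_derivative_const mul_right_has_derivative] by blast
  have "((\<lambda>q. ?f (mul (c t) q)) has_derivative (\<lambda>u. F (left_inv mul u (c t)))) (at 0)"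
    using has_derivative_compose[OF mul_left_has_derivative[of "c t" 0], of ?f F] F
    by (simp add: left_inv_eq)
  moreover have "((\<lambda>q. mul (?f (c t)) (mul (iv b) (mul q b))) has_derivative
      (\<lambda>u. left_inv mul (Adi b u) (?f (c t)))) (at 0)"
    using mul_has_derivative[OF has_derivative_const[of "?f (c t)"] conjugation_has_derivative[of b]]
    by (simp add: left_inv_eq)
  moreover have "?f (mul (c t) q) = mul (?f (c t)) (mul (iv b) (mul q b))" for q
    by (metis assoc left_neutral right_inverse)
  ultimately have "F (left_inv mul u (c t)) = left_inv mul (Adi b u) (?f (c t))"
    using has_derivative_unique by (metis (no_types, lifting) ext)
  then show ?thesis
    using vector_derivative_diff_chain_within[OF c has_derivative_at_withinI[OF F]] by (simp add: o_def)
qed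

end

section \<open>Functionals on words and their flows\<close>

text \<open>The part of \<open>Hom(U(\<gg>), \<gg>)\<close> vanishing on words of length at least \<open>N\<close>, an element of the
  enveloping algebra \<open>U(\<gg>)\<close> being represented by words.\<close>

definition admissible :: "('g::real_vector \<Rightarrow> 'g \<Rightarrow> 'g) \<Rightarrow> nat \<Rightarrow> 'g tower set" where
  "admissible br N = {F. (\<forall>Ys. N \<le> length Ys \<longrightarrow> F Ys = 0) \<and>
     (\<forall>As Zs. linear (\<lambda>Y. F (As @ Y # Zs))) \<and>
     (\<forall>As X Y Zs. F (As @ br X Y # Zs) = F (As @ X # Y # Zs) - F (As @ Y # X # Zs))}"

lemma scaleR_fun_apply: "(c *\<^sub>R f) x = c *\<^sub>R f x"
  by (simp add: scaleR_fun_def)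

lemma admissible_zero: "F \<in> admissible br N \<Longrightarrow> N \<le> length Ys \<Longrightarrow> F Ys = 0"
  by (simp add: admissible_def)

lemma admissible_linear: "F \<in> admissible br N \<Longrightarrow> linear (\<lambda>Y. F (As @ Y # Zs))"
  by (simp add: admissible_def)

lemma admissible_bracket:
  "F \<in> admissible br N \<Longrightarrow> F (As @ br X Y # Zs) = F (As @ X # Y # Zs) - F (As @ Y # X # Zs)"
  by (simp add: admissible_def)

lemma admissible_mono: "F \<in> admissible br M \<Longrightarrow> M \<le> N \<Longrightarrow> F \<in> admissible br N"
  by (auto simp: admissible_def)

lemma admissible_act_Suc:
  assumes "F \<in> admissible br (Suc N)"
  shows "act F Y \<in> admissible br N"
  unfolding admissible_def act_def
  using admissible_zero[OF assms] admissible_linear[OF assms, of "Y # As" for As]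
    admissible_bracket[OF assms, of "Y # As" for As]
  by simp

lemma admissible_act: "F \<in> admissible br N \<Longrightarrow> act F Y \<in> admissible br N"
  using admissible_act_Suc admissible_mono[of F br N "Suc N"] by auto

lemma subspace_admissible: "subspace (admissible br N)"
proof (rule subspaceI)
  show "0 \<in> admissible br N"
    by (simp add: admissible_def linear_zero zero_fun_def)
next
  fix F G assume "F \<in> admissible br N" "G \<in> admissible br N"
  then show "F + G \<in> admissible br N"
    by (auto simp: admissible_def plus_fun_def intro!: linear_compose_add)
next
  fix c F assume "F \<in> admissible br N"
  then show "c *\<^sub>R F \<in> admissible br N"
    by (auto simp: admissible_def scaleR_fun_def scaleR_diff_right intro!: linear_compose_scale_right)
qed

lemma linear_act_vec: "F \<in> admissible br N \<Longrightarrow> linear (\<lambda>Y. act F Y Zs)"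
  using admissible_linear[of F br N "[]" Zs] by (simp add: act_def)

lemma act_act:
  "F \<in> admissible br N \<Longrightarrow> act (act F X) Y = act (act F Y) X + act F (br X Y)"
  using admissible_bracket[of F br N "[]" X Y] by (simp add: fun_eq_iff act_def)

text \<open>The flow \<open>exp (- t act (_) Y)\<close>, cut off at order \<open>N\<close>, which loses nothing
  on \<open>admissible br N\<close>.\<close>

definition tower_exp :: "nat \<Rightarrow> real \<Rightarrow> 'g::real_vector \<Rightarrow> 'g tower \<Rightarrow> 'g tower" where
  "tower_exp N t Y F = (\<lambda>Zs. \<Sum>m<N. ((- t) ^ m / fact m) *\<^sub>R F (replicate m Y @ Zs))"

lemma tower_exp_add: "tower_exp N t Y (F + G) = tower_exp N t Y F + tower_exp N t Y G"
  by (simp add: tower_exp_def fun_eq_iff scaleR_add_right sum.distrib)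

lemma tower_exp_scale: "tower_exp N t Y (c *\<^sub>R F) = c *\<^sub>R tower_exp N t Y F"
  by (simp add: tower_exp_def fun_eq_iff scaleR_fun_def scaleR_sum_right mult.commute)

lemma linear_tower_exp: "linear (tower_exp N t Y)"
  by (rule linearI) (simp_all add: tower_exp_add tower_exp_scale)

lemma tower_exp_0:
  assumes "F \<in> admissible br N"
  shows "tower_exp N 0 Y F = F"
proof (cases N)
  case 0
  then show ?thesis
    using admissible_zero[OF assms] by (simp add: tower_exp_def fun_eq_iff)
next
  case (Suc M)
  then show ?thesis
    by (simp add: tower_exp_def fun_eq_iff sum.lessThan_Suc_shift del: sum.lessThan_Suc)
qed

lemma admissible_tower_exp:
  assumes F: "F \<in> admissible br M"
  shows "tower_exp N t Y F \<in> admissible br M"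
proof -
  have "linear (\<lambda>Z. F (replicate m Y @ As @ Z # Zs))" for m As Zs
    using admissible_linear[OF F, of "replicate m Y @ As" Zs] by simp
  moreover have "F (replicate m Y @ As @ br A B # Zs) =
      F (replicate m Y @ As @ A # B # Zs) - F (replicate m Y @ As @ B # A # Zs)" for m As A B Zs
    using admissible_bracket[OF F, of "replicate m Y @ As"] by simp
  ultimately show ?thesis
    unfolding admissible_def tower_exp_def
    by (auto simp: admissible_zero[OF F] scaleR_diff_right sum_subtractf
        intro!: linear_compose_sum linear_compose_scale_right)
qed

text \<open>Product rule for the flow of a moving functional. Differentiating the coefficients loses
  the top term of the sum, but that term would evaluate \<open>H t\<close> on a word of length at
  least \<open>N\<close>.\<close>

lemma tower_exp_has_vector_derivative:
  fixes H :: "real \<Rightarrow> 'g::real_normed_vector tower"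
  assumes H: "\<And>Zs. ((\<lambda>t. H t Zs) has_vector_derivative H' Zs) (at t)"
    and adm: "H t \<in> admissible br N"
  shows "((\<lambda>t. tower_exp N t Y (H t) Zs) has_vector_derivative
    (tower_exp N t Y H' Zs - tower_exp N t Y (act (H t) Y) Zs)) (at t)"
proof -
  \<comment> \<open>The case \<open>m = 0\<close> is separate because \<open>m - 1\<close> is
    truncated at 0 and the general formula would give -1.\<close>
  define c' where "c' m = (if m = 0 then 0 else - ((- t) ^ (m - 1) / fact (m - 1)))" for m
  have c': "((\<lambda>t. (- t) ^ m / fact m) has_real_derivative c' m) (at t)" for m
  proof (cases m)
    case (Suc k)
    have "((\<lambda>t. (- t) ^ Suc k / fact (Suc k)) has_real_derivative
        (of_nat (Suc k) * (- 1 * (- t) ^ (Suc k - Suc 0))) / fact (Suc k)) (at t)"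
      by (intro DERIV_cdivide DERIV_power DERIV_minus DERIV_ident)
    also have "(of_nat (Suc k) * (- 1 * (- t) ^ (Suc k - Suc 0))) / fact (Suc k) = c' m"
      unfolding c'_def Suc fact_Suc by (simp del: of_nat_Suc)
    finally show ?thesis by (simp add: Suc)
  qed (simp add: c'_def)
  have "((\<lambda>t. tower_exp N t Y (H t) Zs) has_vector_derivative
    (\<Sum>m<N. ((- t) ^ m / fact m) *\<^sub>R H' (replicate m Y @ Zs) + c' m *\<^sub>R H t (replicate m Y @ Zs))) (at t)"
    unfolding tower_exp_def
    by (intro has_vector_derivative_sum has_vector_derivative_scaleR c' H)
  moreover have "(\<Sum>m<N. c' m *\<^sub>R H t (replicate m Y @ Zs)) = - tower_exp N t Y (act (H t) Y) Zs"
  proof (cases N)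
    case (Suc k)
    have "act (H t) Y (replicate k Y @ Zs) = 0"
      using admissible_zero[OF adm, of "Y # replicate k Y @ Zs"] by (simp add: act_def Suc)
    then have "tower_exp N t Y (act (H t) Y) Zs =
        (\<Sum>m<k. ((- t) ^ m / fact m) *\<^sub>R H t (Y # replicate m Y @ Zs))"
      by (simp add: tower_exp_def Suc act_def)
    moreover have "(\<Sum>m<N. c' m *\<^sub>R H t (replicate m Y @ Zs)) =
        (\<Sum>m<k. - (((- t) ^ m / fact m) *\<^sub>R H t (Y # replicate m Y @ Zs)))"
      unfolding Suc sum.lessThan_Suc_shift by (simp add: c'_def)
    ultimately show ?thesis by (simp add: sum_negf)
  qed (simp add: tower_exp_def)
  ultimately show ?thesis
    by (simp add: sum.distrib tower_exp_def)
qed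

text \<open>The difference of both sides has as its derivative minus the same difference for
  \<open>act F Y\<close>, which vanishes on shorter words than \<open>F\<close>.\<close>

lemma tower_exp_act:
  fixes br :: "'g::euclidean_space \<Rightarrow> 'g \<Rightarrow> 'g"
  assumes W: "\<And>t. (W has_vector_derivative - br Y (W t)) (at t)"
    and anti: "\<And>x y. br x y = - br y x"
    and F: "F \<in> admissible br N"
  shows "act (tower_exp N t Y F) (W 0) = tower_exp N t Y (act F (W t))"
proof -
  \<comment> \<open>The length bound \<open>M\<close> drops with each bracket and carries the
    induction, while the order \<open>N\<close> of the flow stays fixed.\<close>
  have "M \<le> N \<Longrightarrow> F \<in> admissible br M \<Longrightarrow>
      tower_exp N t Y F (W 0 # Zs) = tower_exp N t Y (act F (W t)) Zs" for M t Zs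
    using F
  proof (induction M arbitrary: F t Zs)
    case 0
    then have "F = (\<lambda>_. 0)"
      using admissible_zero by fastforce
    then show ?case by (simp add: tower_exp_def act_def)
  next
    case (Suc M)
    note F = \<open>F \<in> admissible br N\<close>
    define \<delta> where "\<delta> t = tower_exp N t Y F (W 0 # Zs) - tower_exp N t Y (act F (W t)) Zs" for t
    have "(\<delta> has_vector_derivative 0) (at t)" for t
    proof -
      have act: "((\<lambda>t. act F (W t) Zs) has_vector_derivative act F (- br Y (W t)) Zs) (at t)" for Zs
        using bounded_linear.has_vector_derivative[OF linear_act_vec[OF F, THEN linear_conv_bounded_linear[THEN iffD1]] W] .
      have "((\<lambda>t. tower_exp N t Y F (W 0 # Zs)) has_vector_derivative
          tower_exp N t Y (\<lambda>_. 0) (W 0 # Zs) - tower_exp N t Y (act F Y) (W 0 # Zs)) (at t)"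
        by (rule tower_exp_has_vector_derivative[OF _ F]) simp
      then have "(\<delta> has_vector_derivative
          (tower_exp N t Y (\<lambda>_. 0) (W 0 # Zs) - tower_exp N t Y (act F Y) (W 0 # Zs)) -
          (tower_exp N t Y (act F (- br Y (W t))) Zs - tower_exp N t Y (act (act F (W t)) Y) Zs)) (at t)"
        unfolding \<delta>_def
        by (intro has_vector_derivative_diff tower_exp_has_vector_derivative[OF act admissible_act[OF F]])
      moreover have "tower_exp N t Y (act (act F (W t)) Y) Zs =
          tower_exp N t Y (act (act F Y) (W t)) Zs + tower_exp N t Y (act F (br (W t) Y)) Zs"
        by (simp add: act_act[OF F, of "W t" Y] tower_exp_add)
      moreover have "tower_exp N t Y (act F Y) (W 0 # Zs) = tower_exp N t Y (act (act F Y) (W t)) Zs"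
        using Suc.prems F by (intro Suc.IH) (auto intro: admissible_act admissible_act_Suc)
      ultimately show ?thesis
        using anti[of "W t" Y] by (simp add: tower_exp_def)
    qed
    then have "\<delta> t = \<delta> 0"
      using has_vector_derivative_zero_constant[of UNIV \<delta>] by (metis UNIV_I convex_UNIV)
    then show ?case
      using tower_exp_0[OF F] tower_exp_0[OF admissible_act[OF F]]
      by (simp add: \<delta>_def act_def)
  qed
  from this[of N] show ?thesis
    using F by (intro ext) (simp add: act_def)
qed

lemma linear_foldl:
  assumes "\<And>y. linear (\<lambda>x. br x y)"
  shows "linear (\<lambda>X. foldl br X Ys)"
proof (induction Ys)
  case (Cons Y Ys)
  then show ?case
    using linear_compose[OF assms[of Y] Cons] by (simp add: o_def)
qed (simp add: linear_ident)

lemma linear_embed: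
  assumes "\<And>y. linear (\<lambda>x. br x y)"
  shows "linear (embed br)"
  using linear_add[OF linear_foldl[of br, OF assms]] linear_scale[OF linear_foldl[of br, OF assms]]
  by (intro linearI) (simp_all add: embed_def fun_eq_iff scaleR_fun_def)

text \<open>The motion of \<open>W\<close> contributes the embedding of \<open>br (W t) Y\<close>
  and the flow contributes its negative, so the left-hand side is constant in \<open>t\<close>. Thus
  on embedded elements the flow is the adjoint action of the exponential of
  \<open>t *\<^sub>R Y\<close>.\<close>

lemma tower_exp_embed:
  fixes br :: "'g::euclidean_space \<Rightarrow> 'g \<Rightarrow> 'g"
  assumes W: "\<And>t. (W has_vector_derivative - br Y (W t)) (at t)"
    and anti: "\<And>x y. br x y = - br y x"
    and lin: "\<And>y. linear (\<lambda>x. br x y)"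
    and adm: "\<And>z. embed br z \<in> admissible br N"
  shows "tower_exp N t Y (embed br (W t)) = embed br (W 0)"
proof
  fix Zs
  define \<delta> where "\<delta> t = tower_exp N t Y (embed br (W t)) Zs" for t
  have emb: "((\<lambda>t. embed br (W t) Zs) has_vector_derivative embed br (- br Y (W t)) Zs) (at t)" for Zs t
    using bounded_linear.has_vector_derivative[OF linear_foldl[of br, OF lin, THEN linear_conv_bounded_linear[THEN iffD1]] W]
    unfolding embed_def .
  have "(\<delta> has_vector_derivative 0) (at t)" for t
    using tower_exp_has_vector_derivative[OF emb adm, where Y = Y and Zs = Zs and t = t] anti[of "W t" Y]
    by (simp add: \<delta>_def[abs_def] act_embed)
  then have "\<delta> t = \<delta> 0"
    using has_vector_derivative_zero_constant[of UNIV \<delta>] by (metis UNIV_I convex_UNIV)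
  then show "tower_exp N t Y (embed br (W t)) Zs = embed br (W 0) Zs"
    by (simp add: \<delta>_def tower_exp_0[OF adm])
qed

text \<open>With \<open>fold\<close> the flow of the first index acts first, so letters enter a word
  in the order of \<open>js\<close>, as in the iterated brackets.\<close>

definition tower_prod :: "nat \<Rightarrow> ('n \<Rightarrow> 'g::real_vector) \<Rightarrow> 'n list \<Rightarrow> real^'n \<Rightarrow> 'g tower \<Rightarrow> 'g tower" where
  "tower_prod N Y js x = fold (\<lambda>j. tower_exp N (x $ j) (Y j)) js"

lemma tower_prod_simps [simp]:
  "tower_prod N Y [] x F = F"
  "tower_prod N Y (j # js) x F = tower_prod N Y js x (tower_exp N (x $ j) (Y j) F)"
  "tower_prod N Y (js @ ks) x F = tower_prod N Y ks x (tower_prod N Y js x F)"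
  by (simp_all add: tower_prod_def)

lemma linear_tower_prod: "linear (tower_prod N Y js x)"
proof (induction js)
  case (Cons j js)
  have "tower_prod N Y (j # js) x = tower_prod N Y js x \<circ> tower_exp N (x $ j) (Y j)"
    by (simp add: fun_eq_iff)
  then show ?case
    using linear_compose[OF linear_tower_exp Cons] by metis
qed (simp add: linear_ident tower_prod_def id_def)

lemma admissible_tower_prod:
  "F \<in> admissible br M \<Longrightarrow> tower_prod N Y js x F \<in> admissible br M"
  by (induction js arbitrary: F) (simp_all add: admissible_tower_exp)

lemma tower_prod_cong:
  "(\<And>j. j \<in> set js \<Longrightarrow> x $ j = y $ j) \<Longrightarrow> tower_prod N Y js x F = tower_prod N Y js y F"
  by (induction js arbitrary: F) simp_all

lemma tower_prod_0:
  "F \<in> admissible br N \<Longrightarrow> tower_prod N Y js 0 F = F"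
  by (induction js arbitrary: F) (simp_all add: tower_exp_0)

lemma tower_prod_has_vector_derivative:
  fixes H :: "real \<Rightarrow> 'g::real_normed_vector tower"
  assumes "\<And>Zs. ((\<lambda>t. H t Zs) has_vector_derivative H' Zs) (at t)"
  shows "((\<lambda>t. tower_prod N Y js x (H t) Zs) has_vector_derivative tower_prod N Y js x H' Zs) (at t)"
  using assms
proof (induction js arbitrary: H H' Zs)
  case (Cons j js)
  have "((\<lambda>t. tower_exp N (x $ j) (Y j) (H t) Zs) has_vector_derivative
      tower_exp N (x $ j) (Y j) H' Zs) (at t)" for Zs
    unfolding tower_exp_def
    by (intro has_vector_derivative_sum
        bounded_linear.has_vector_derivative[OF bounded_linear_scaleR_right] Cons.prems)
  from Cons.IH[OF this] show ?case by simp
qed simp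

lemma tower_prod_differentiable:
  fixes H :: "real^'n \<Rightarrow> 'g::real_normed_vector tower"
  assumes "\<And>Zs. (\<lambda>x. H x Zs) differentiable (at x)"
  shows "(\<lambda>x. tower_prod N Y js x (H x) Zs) differentiable (at x)"
  using assms
proof (induction js arbitrary: H Zs)
  case (Cons j js)
  have "(\<lambda>x. x $ j) differentiable (at x)"
    by (intro bounded_linear_imp_differentiable bounded_linear_vec_nth)
  then have "(\<lambda>x. tower_exp N (x $ j) (Y j) (H x) Zs) differentiable (at x)" for Zs
    unfolding tower_exp_def
    by (intro differentiable_sum finite_lessThan ballI differentiable_scaleR differentiable_divide
        differentiable_power differentiable_minus differentiable_const Cons.prems) auto
  from Cons.IH[OF this] show ?case by simp
qed simp

section \<open>Lipschitz dependence of the products of flows on the coordinates\<close>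

lemma lipschitz_on_scaleR_compact:
  fixes f :: "'a::metric_space \<Rightarrow> real" and g :: "'a \<Rightarrow> 'b::real_normed_vector"
  assumes K: "compact K" and f: "\<exists>L. L-lipschitz_on K f" and g: "\<exists>L. L-lipschitz_on K g"
  shows "\<exists>L. L-lipschitz_on K (\<lambda>x. f x *\<^sub>R g x)"
proof -
  obtain A B where A: "A-lipschitz_on K f" and B: "B-lipschitz_on K g"
    using f g by blast
  obtain a where a: "\<And>x. x \<in> K \<Longrightarrow> norm (f x) \<le> a"
    using compact_imp_bounded[OF compact_continuous_image[OF lipschitz_on_continuous_on[OF A] K]]
    by (auto simp: bounded_iff)
  obtain b where b: "\<And>x. x \<in> K \<Longrightarrow> norm (g x) \<le> b"
    using compact_imp_bounded[OF compact_continuous_image[OF lipschitz_on_continuous_on[OF B] K]]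
    by (auto simp: bounded_iff)
  \<comment> \<open>The absolute values keep the constant nonnegative when \<open>K\<close> is
    empty.\<close>
  have "dist (f x *\<^sub>R g x) (f y *\<^sub>R g y) \<le> (\<bar>a\<bar> * B + A * \<bar>b\<bar>) * dist x y" if "x \<in> K" "y \<in> K" for x y
  proof -
    have "f x *\<^sub>R g x - f y *\<^sub>R g y = f x *\<^sub>R (g x - g y) + (f x - f y) *\<^sub>R g y"
      by (simp add: algebra_simps)
    then have "dist (f x *\<^sub>R g x) (f y *\<^sub>R g y) \<le> \<bar>f x\<bar> * dist (g x) (g y) + dist (f x) (f y) * norm (g y)"
      by (metis dist_norm norm_scaleR norm_triangle_ineq real_norm_def)
    also have "\<dots> \<le> \<bar>a\<bar> * (B * dist x y) + (A * dist x y) * \<bar>b\<bar>"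
      using a[OF that(1)] b[OF that(2)] lipschitz_onD[OF A that] lipschitz_onD[OF B that]
        lipschitz_on_nonneg[OF A]
      by (intro add_mono mult_mono) (auto intro: order_trans[OF _ abs_ge_self])
    finally show ?thesis by (simp add: algebra_simps)
  qed
  then show ?thesis
    using lipschitz_on_nonneg[OF A] lipschitz_on_nonneg[OF B]
    by (intro exI[of _ "\<bar>a\<bar> * B + A * \<bar>b\<bar>"] lipschitz_onI) auto
qed

lemma lipschitz_on_sum_ex:
  fixes f :: "'i \<Rightarrow> 'a::metric_space \<Rightarrow> 'b::real_normed_vector"
  assumes "\<And>i. i \<in> I \<Longrightarrow> \<exists>L. L-lipschitz_on K (f i)"
  shows "\<exists>L. L-lipschitz_on K (\<lambda>x. \<Sum>i\<in>I. f i x)"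
  using assms
proof (induction I rule: infinite_finite_induct)
  case (insert i I)
  obtain A where A: "A-lipschitz_on K (f i)" using insert.prems by blast
  obtain B where B: "B-lipschitz_on K (\<lambda>x. \<Sum>i\<in>I. f i x)" using insert by blast
  from lipschitz_on_add[OF A B] show ?case
    using insert by auto
qed (auto intro: lipschitz_on_constant)

text \<open>The dependence on the coordinates is polynomial. This provides the Lipschitz condition
  that the definition of an abnormal extremal puts on the dual curve.\<close>

lemma tower_prod_lipschitz:
  fixes H :: "'a::metric_space \<Rightarrow> 'g::real_normed_vector tower"
  assumes K: "compact K" and c: "L-lipschitz_on K c"
    and "\<And>Zs. \<exists>L. L-lipschitz_on K (\<lambda>t. H t Zs)"
  shows "\<exists>L. L-lipschitz_on K (\<lambda>t. tower_prod N Y js (c t) (H t) Zs)"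
  using assms(3)
proof (induction js arbitrary: H Zs)
  case (Cons j js)
  have cj: "L-lipschitz_on K (\<lambda>t. - (c t $ j))"
    using lipschitz_onD[OF c] lipschitz_on_nonneg[OF c]
    by (intro lipschitz_onI) (simp_all only: dist_minus, meson dist_vec_nth_le order_trans)
  have pow: "\<exists>L. L-lipschitz_on K (\<lambda>t. (- (c t $ j)) ^ m)" for m
  proof (induction m)
    case (Suc m)
    then show ?case
      using lipschitz_on_scaleR_compact[OF K _ Suc] cj by fastforce
  qed (auto intro: lipschitz_on_constant)
  have "\<exists>L. L-lipschitz_on K (\<lambda>t. tower_exp N (c t $ j) (Y j) (H t) Zs)" for Zs
    unfolding tower_exp_def
  proof (intro lipschitz_on_sum_ex lipschitz_on_scaleR_compact[OF K] Cons.prems)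
    fix m
    have "\<exists>L. L-lipschitz_on K (\<lambda>_. inverse (fact m) :: real)"
      by (blast intro: lipschitz_on_constant)
    from lipschitz_on_scaleR_compact[OF K this pow[of m]]
    show "\<exists>L. L-lipschitz_on K (\<lambda>t. (- (c t $ j)) ^ m / fact m)"
      by (simp add: divide_inverse mult.commute)
  qed
  from Cons.IH[OF this] show ?case by simp
qed simp

text \<open>Multiplying out the exponential sums produces the multi-index sum of the extremal
  polynomials, cut off at exponents below \<open>N\<close>.\<close>

lemma tower_prod_expand:
  fixes Y :: "'n::finite \<Rightarrow> 'g::real_vector"
  assumes "distinct js"
  shows "tower_prod N Y js x F Zs =
    (\<Sum>\<alpha> | (\<forall>j\<in>set js. \<alpha> j < N) \<and> (\<forall>j. j \<notin> set js \<longrightarrow> \<alpha> j = (0::nat)).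
      (\<Prod>j\<in>set js. (- (x $ j)) ^ \<alpha> j / fact (\<alpha> j)) *\<^sub>R
        F (concat (map (\<lambda>j. replicate (\<alpha> j) (Y j)) js) @ Zs))"
  using assms
proof (induction js arbitrary: F Zs)
  case Nil
  have "{\<alpha>::'n \<Rightarrow> nat. \<forall>j. \<alpha> j = 0} = {\<lambda>_. 0}" by auto
  then show ?case by simp
next
  case (Cons i js)
  define A where "A js = {\<alpha>::'n \<Rightarrow> nat. (\<forall>j\<in>set js. \<alpha> j < N) \<and> (\<forall>j. j \<notin> set js \<longrightarrow> \<alpha> j = 0)}" for js
  have i: "i \<notin> set js" using Cons.prems by simp
  have upd: "(\<Prod>j\<in>set (i # js). (- (x $ j)) ^ (\<alpha>(i := m)) j / fact ((\<alpha>(i := m)) j)) =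
      ((- (x $ i)) ^ m / fact m) * (\<Prod>j\<in>set js. (- (x $ j)) ^ \<alpha> j / fact (\<alpha> j))"
    "concat (map (\<lambda>j. replicate ((\<alpha>(i := m)) j) (Y j)) (i # js)) =
      replicate m (Y i) @ concat (map (\<lambda>j. replicate (\<alpha> j) (Y j)) js)" for m \<alpha>
  proof -
    have "(\<Prod>j\<in>set js. (- (x $ j)) ^ (\<alpha>(i := m)) j / fact ((\<alpha>(i := m)) j)) =
        (\<Prod>j\<in>set js. (- (x $ j)) ^ \<alpha> j / fact (\<alpha> j))"
      using i by (intro prod.cong) auto
    then show "(\<Prod>j\<in>set (i # js). (- (x $ j)) ^ (\<alpha>(i := m)) j / fact ((\<alpha>(i := m)) j)) =
      ((- (x $ i)) ^ m / fact m) * (\<Prod>j\<in>set js. (- (x $ j)) ^ \<alpha> j / fact (\<alpha> j))"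
      using i by simp
    have "map (\<lambda>j. replicate ((\<alpha>(i := m)) j) (Y j)) js = map (\<lambda>j. replicate (\<alpha> j) (Y j)) js"
      using i by (intro map_cong) auto
    then show "concat (map (\<lambda>j. replicate ((\<alpha>(i := m)) j) (Y j)) (i # js)) =
      replicate m (Y i) @ concat (map (\<lambda>j. replicate (\<alpha> j) (Y j)) js)"
      by (simp only: list.map concat.simps fun_upd_same)
  qed
  \<comment> \<open>A multi-index on \<open>i # js\<close> is one on \<open>js\<close> together with
    its exponent at \<open>i\<close>.\<close>
  have bij: "bij_betw (\<lambda>(\<alpha>, m). \<alpha>(i := m)) (A js \<times> {..<N}) (A (i # js))"
    by (rule bij_betw_byWitness[where f' = "\<lambda>\<beta>. (\<beta>(i := 0), \<beta> i)"])
      (use i in \<open>auto simp: A_def fun_eq_iff split: if_splits\<close>)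
  have "tower_prod N Y (i # js) x F Zs = (\<Sum>\<alpha>\<in>A js. \<Sum>m<N.
      (\<Prod>j\<in>set js. (- (x $ j)) ^ \<alpha> j / fact (\<alpha> j)) *\<^sub>R ((- (x $ i)) ^ m / fact m) *\<^sub>R
        F (replicate m (Y i) @ concat (map (\<lambda>j. replicate (\<alpha> j) (Y j)) js) @ Zs))"
    using Cons.prems by (simp add: Cons.IH tower_exp_def A_def scaleR_sum_right)
  also have "\<dots> = (\<Sum>(\<alpha>, m)\<in>A js \<times> {..<N}.
      (\<Prod>j\<in>set (i # js). (- (x $ j)) ^ (\<alpha>(i := m)) j / fact ((\<alpha>(i := m)) j)) *\<^sub>R
        F (concat (map (\<lambda>j. replicate ((\<alpha>(i := m)) j) (Y j)) (i # js)) @ Zs))"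
    unfolding sum.cartesian_product upd by (intro sum.cong) (auto simp: mult.commute)
  also have "\<dots> = (\<Sum>\<beta>\<in>A (i # js).
      (\<Prod>j\<in>set (i # js). (- (x $ j)) ^ \<beta> j / fact (\<beta> j)) *\<^sub>R
        F (concat (map (\<lambda>j. replicate (\<beta> j) (Y j)) (i # js)) @ Zs))"
    by (subst sum.reindex_bij_betw[OF bij, symmetric]) (simp add: case_prod_unfold)
  finally show ?case by (simp add: A_def)
qed

section \<open>Coordinates of the second kind\<close>

lemma lie_algebra_antisym:
  assumes "lie_algebra br"
  shows "br x y = - br y x"
proof -
  have l: "linear (\<lambda>y. br x y)" "linear (\<lambda>x. br x y)" "br x x = 0" for x y
    using assms by (simp_all add: lie_algebra_def)
  have "br (x + y) (x + y) = br x x + br y x + (br x y + br y y)"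
    by (simp only: linear_add[OF l(1)] linear_add[OF l(2)])
  then show ?thesis by (simp add: l(3) eq_neg_iff_add_eq_0 add.commute)
qed

locale exp_group = smooth_group mul iv
  for mul :: "real^'n \<Rightarrow> real^'n \<Rightarrow> real^'n" and iv :: "real^'n \<Rightarrow> real^'n" +
  fixes E :: "real^'n \<Rightarrow> real^'n" and Y :: "'n \<Rightarrow> real^'n"
  assumes E: "exponential_map mul E"
    and lie: "lie_algebra (lie_bracket mul)"
begin

abbreviation br where "br \<equiv> lie_bracket mul"

lemma linear_br: "linear (\<lambda>y. br x y)" "linear (\<lambda>x. br x y)"
  using lie by (simp_all add: lie_algebra_def)

lemma Adi_exp_has_vector_derivative:
  "((\<lambda>t. Adi (E (t *\<^sub>R y)) z) has_vector_derivative - br y (Adi (E (t *\<^sub>R y)) z)) (at t)"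
  by (rule Adi_along_curve) (use E in \<open>simp add: exponential_map_def\<close>)

lemma E_0 [simp]: "E 0 = 0"
  using E by (simp add: exponential_map_def)

lemma act_tower_exp:
  assumes "F \<in> admissible br N"
  shows "act (tower_exp N t y F) z = tower_exp N t y (act F (Adi (E (t *\<^sub>R y)) z))"
  using tower_exp_act[OF Adi_exp_has_vector_derivative lie_algebra_antisym[OF lie] assms, of t y z]
  by simp

lemma tower_exp_embed_Adi:
  assumes "\<And>z. embed br z \<in> admissible br N"
  shows "tower_exp N t y (embed br (Adi (E (t *\<^sub>R y)) z)) = embed br z"
  using tower_exp_embed[OF Adi_exp_has_vector_derivative lie_algebra_antisym[OF lie] linear_br(2) assms,
      of t y z]
  by simp

text \<open>The list is reversed so that the first index gives the rightmost factor; appending to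
  \<open>js\<close> then multiplies on the left.\<close>

definition gprod :: "'n list \<Rightarrow> real^'n \<Rightarrow> real^'n" where
  "gprod js x = foldr mul (map (\<lambda>j. E ((x $ j) *\<^sub>R Y j)) (rev js)) 0"

lemma gprod_Nil [simp]: "gprod [] x = 0"
  by (simp add: gprod_def)

lemma gprod_append: "gprod (js @ ks) x = mul (gprod ks x) (gprod js x)"
proof -
  have *: "foldr mul gs h = mul (foldr mul gs 0) h" for gs h
    by (induction gs) (simp_all add: assoc)
  show ?thesis
    unfolding gprod_def rev_append map_append foldr_append by (rule *)
qed

lemma gprod_single [simp]: "gprod [j] x = E ((x $ j) *\<^sub>R Y j)"
  by (simp add: gprod_def)

lemma gprod_cong: "(\<And>j. j \<in> set js \<Longrightarrow> x $ j = y $ j) \<Longrightarrow> gprod js x = gprod js y"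
  unfolding gprod_def by (metis (mono_tags, lifting) map_cong set_rev)

text \<open>Each flow lets a bracket pass at the cost of the inverse adjoint action of its
  exponential, and \<open>Adi_mul\<close> collects these costs into one.\<close>

lemma act_tower_prod:
  assumes "F \<in> admissible br N"
  shows "act (tower_prod N Y js x F) z = tower_prod N Y js x (act F (Adi (gprod js x) z))"
proof (induction js arbitrary: z rule: rev_induct)
  case (snoc j js)
  show ?case
    by (simp add: act_tower_exp admissible_tower_prod assms snoc gprod_append Adi_mul)
qed simp

lemma tower_prod_embed:
  assumes "\<And>z. embed br z \<in> admissible br N"
  shows "tower_prod N Y js x (embed br (Adi (gprod js x) z)) = embed br z"
proof (induction js arbitrary: z rule: rev_induct)
  case (snoc j js)
  show ?case
    by (simp add: gprod_append Adi_mul snoc tower_exp_embed_Adi assms)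
qed simp

text \<open>Along an exponential curve \<open>Adi\<close> changes a vector by brackets only, which
  \<open>p\<close> does not see. The intended \<open>p\<close> are the coordinates of degree
  1.\<close>

lemma Adi_gprod_invariant:
  assumes p: "linear p" and br: "\<And>y z. p (br y z) = 0"
  shows "p (Adi (gprod js x) z) = (p z :: real)"
proof (induction js arbitrary: z rule: rev_induct)
  case (snoc j js)
  have "p (Adi (E (t *\<^sub>R y)) z) = p z" for t y
  proof -
    have "((\<lambda>t. p (Adi (E (t *\<^sub>R y)) z)) has_vector_derivative 0) (at t)" for t
      using bounded_linear.has_vector_derivative[OF p[THEN linear_conv_bounded_linear[THEN iffD1]]
          Adi_exp_has_vector_derivative, of y z t]
      by (simp add: linear_neg[OF p] br)
    then have "p (Adi (E (t *\<^sub>R y)) z) = p (Adi (E (0 *\<^sub>R y)) z)"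
      using has_vector_derivative_zero_constant[of UNIV "\<lambda>t. p (Adi (E (t *\<^sub>R y)) z)"]
      by (metis UNIV_I convex_UNIV)
    then show ?thesis by simp
  qed
  then show ?case
    by (simp add: gprod_append Adi_mul snoc)
qed simp

end

locale exp_coordinates = exp_group mul iv E Y
  for mul :: "real^'n \<Rightarrow> real^'n \<Rightarrow> real^'n" and iv E Y +
  fixes js :: "'n list"
  assumes distinct_js: "distinct js" and set_js: "set js = UNIV"
    and coords: "\<And>x. gprod js x = x"
begin

text \<open>The coordinate field \<open>\<partial>\<^sub>k\<close> at \<open>x\<close> is the left-invariant field of \<open>coord_dir x k\<close>.\<close>

definition coord_dir :: "real^'n \<Rightarrow> 'n \<Rightarrow> real^'n" where
  "coord_dir x k = Adi (gprod (takeWhile (\<lambda>j. j \<noteq> k) js) x) (Y k)"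

lemma split_js:
  obtains as ks where "takeWhile (\<lambda>j. j \<noteq> k) js = as" "js = as @ k # ks"
    "k \<notin> set as" "k \<notin> set ks"
proof -
  have k: "k \<in> set js" by (simp add: set_js)
  then obtain as bs where "js = as @ k # bs" "k \<notin> set as"
    by (meson split_list_first)
  moreover from this have "takeWhile (\<lambda>j. j \<noteq> k) js = as"
    by (simp add: takeWhile_tail) (metis takeWhile_eq_all_conv)
  ultimately show ?thesis
    using that distinct_js by (metis distinct.simps(2) distinct_append)
qed

text \<open>The coordinate line through \<open>x\<close> moves a single exponential between two
  fixed factors; passing it through the right-hand factor conjugates \<open>Y k\<close> into
  \<open>coord_dir x k\<close>.\<close>

lemma axis_eq_left_inv: "axis k 1 = left_inv mul (coord_dir x k) x"
proof -
  obtain as ks where as: "takeWhile (\<lambda>j. j \<noteq> k) js = as" and js: "js = as @ k # ks"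
    and k: "k \<notin> set as" "k \<notin> set ks"
    by (rule split_js)
  define z where "z t = x + (t - x $ k) *\<^sub>R axis k 1" for t
  have zj: "j \<noteq> k \<Longrightarrow> z t $ j = x $ j" and zk: "z t $ k = t" for t j
    by (simp_all add: z_def axis_def)
  have eq: "gprod js (z t) = mul (gprod ks x) (mul (E (t *\<^sub>R Y k)) (gprod as x))" for t
  proof -
    have "gprod js (z t) = mul (gprod ks (z t)) (mul (gprod [k] (z t)) (gprod as (z t)))"
      unfolding gprod_append[symmetric] js by simp
    moreover have "gprod ks (z t) = gprod ks x" "gprod as (z t) = gprod as x"
      using k zj by (auto intro!: gprod_cong) metis+
    ultimately show ?thesis by (simp add: zk)
  qed
  have zx: "z (x $ k) = x" by (simp add: z_def)
  have "((\<lambda>t. mul (gprod ks x) (mul (E (t *\<^sub>R Y k)) (gprod as x))) has_vector_derivative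
      left_inv mul (Adi (gprod as x) (Y k))
        (mul (gprod ks x) (mul (E ((x $ k) *\<^sub>R Y k)) (gprod as x)))) (at (x $ k))"
    by (rule translate_has_vector_derivative) (use E in \<open>simp add: exponential_map_def\<close>)
  then have "(z has_vector_derivative left_inv mul (coord_dir x k) x) (at (x $ k))"
    by (simp add: eq[symmetric] coords zx coord_dir_def as)
  moreover have "(z has_vector_derivative axis k 1) (at (x $ k))"
    unfolding z_def by (auto intro!: derivative_eq_intros)
  ultimately show ?thesis
    using vector_derivative_unique_at by metis
qed

lemma coord_dir_expand:
  "h = left_inv mul (\<Sum>k\<in>UNIV. (h $ k) *\<^sub>R coord_dir x k) x"
proof -
  have "h = (\<Sum>k\<in>UNIV. (h $ k) *\<^sub>R axis k 1)"
    by (simp add: basis_expansion scalar_mult_eq_scaleR[symmetric])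
  also have "\<dots> = (\<Sum>k\<in>UNIV. (h $ k) *\<^sub>R left_inv mul (coord_dir x k) x)"
    by (simp only: axis_eq_left_inv[of _ x])
  also have "\<dots> = left_inv mul (\<Sum>k\<in>UNIV. (h $ k) *\<^sub>R coord_dir x k) x"
    by (simp only: linear_sum[OF linear_left_inv] linear_scale[OF linear_left_inv])
  finally show ?thesis .
qed

text \<open>A vector-valued form of the extremal polynomials: pairing \<open>pol N (X i) x\<close>
  with \<open>v\<close> gives the polynomial of index \<open>i\<close>.\<close>

definition pol :: "nat \<Rightarrow> (real^'n) tower \<Rightarrow> real^'n \<Rightarrow> real^'n" where
  "pol N F x = g_part (tower_prod N Y js x F)"

lemma linear_pol: "linear (\<lambda>F. pol N F x)"
  unfolding pol_def g_part_def
  by (intro linearI)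
    (simp_all only: linear_add[OF linear_tower_prod] linear_scale[OF linear_tower_prod]
      plus_fun_apply scaleR_fun_apply)

lemma linear_pol_act: "F \<in> admissible br N \<Longrightarrow> linear (\<lambda>y. pol N (act F y) x)"
proof -
  assume F: "F \<in> admissible br N"
  have "linear (\<lambda>y. act F y)"
    using linear_add[OF linear_act_vec[OF F]] linear_scale[OF linear_act_vec[OF F]]
    by (intro linearI) (simp_all add: fun_eq_iff scaleR_fun_def)
  from linear_compose[OF this linear_pol] show ?thesis by (simp add: o_def)
qed

lemma pol_0: "F \<in> admissible br N \<Longrightarrow> pol N F 0 = g_part F"
  by (simp add: pol_def tower_prod_0)

lemma pol_differentiable: "pol N F differentiable (at x)"
  unfolding pol_def[abs_def] g_part_def by (rule tower_prod_differentiable) simp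

text \<open>Only the flow of index \<open>k\<close> moves, and its derivative leaves a bracket with
  \<open>Y k\<close> in the middle of the product. Carrying this bracket back past the flows of
  \<open>as\<close> turns \<open>Y k\<close> into \<open>coord_dir x k\<close>.\<close>

lemma pol_partial_derivative:
  assumes F: "F \<in> admissible br N"
  shows "((\<lambda>t. pol N F (x + t *\<^sub>R axis k 1)) has_vector_derivative
    - pol N (act F (coord_dir x k)) x) (at 0)"
proof -
  obtain as ks where as: "takeWhile (\<lambda>j. j \<noteq> k) js = as" and js: "js = as @ k # ks"
    and k: "k \<notin> set as" "k \<notin> set ks"
    by (rule split_js)
  define z where "z t = x + t *\<^sub>R axis k 1" for t
  have zj: "j \<noteq> k \<Longrightarrow> z t $ j = x $ j" and zk: "z t $ k = x $ k + t" for t j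
    by (simp_all add: z_def axis_def)
  let ?G = "tower_prod N Y as x F"
  have G: "?G \<in> admissible br N" by (rule admissible_tower_prod[OF F])
  have split: "tower_prod N Y js y H =
      tower_prod N Y ks y (tower_exp N (y $ k) (Y k) (tower_prod N Y as y H))" for y H
    by (simp add: js)
  have eq: "pol N F (z t) = tower_prod N Y ks x (tower_exp N (x $ k + t) (Y k) ?G) []" for t
  proof -
    have "tower_prod N Y ks (z t) H = tower_prod N Y ks x H"
      "tower_prod N Y as (z t) H = tower_prod N Y as x H" for H
      using k zj by (auto intro!: tower_prod_cong) metis+
    then show ?thesis by (simp only: pol_def g_part_def split zk)
  qed
  have "((\<lambda>t. tower_exp N (x $ k + t) (Y k) ?G Zs) has_vector_derivative
      - tower_exp N (x $ k) (Y k) (act ?G (Y k)) Zs) (at 0)" for Zs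
  proof -
    have "((\<lambda>s. tower_exp N s (Y k) ?G Zs) has_vector_derivative
        - tower_exp N (x $ k) (Y k) (act ?G (Y k)) Zs) (at (x $ k + 0))"
      using tower_exp_has_vector_derivative[of "\<lambda>_. ?G" "\<lambda>_. 0" "x $ k" br N "Y k" Zs] G
      by (simp add: tower_exp_def[of N _ _ "\<lambda>_. 0"])
    moreover have "((\<lambda>t. x $ k + t) has_derivative (\<lambda>t. t)) (at 0)"
      by (auto intro!: derivative_eq_intros)
    ultimately show ?thesis
      unfolding has_vector_derivative_def by (rule has_derivative_compose[rotated])
  qed
  from tower_prod_has_vector_derivative[of "\<lambda>t. tower_exp N (x $ k + t) (Y k) ?G"
      "\<lambda>Zs. - tower_exp N (x $ k) (Y k) (act ?G (Y k)) Zs", OF this]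
  have "((\<lambda>t. pol N F (z t)) has_vector_derivative
      tower_prod N Y ks x (- tower_exp N (x $ k) (Y k) (act ?G (Y k))) []) (at 0)"
    by (simp add: eq fun_Compl_def)
  also have "tower_prod N Y ks x (- tower_exp N (x $ k) (Y k) (act ?G (Y k))) [] =
      - tower_prod N Y js x (act F (coord_dir x k)) []"
    by (simp add: linear_neg[OF linear_tower_prod] act_tower_prod[OF F] split coord_dir_def as)
  finally show ?thesis
    by (simp add: z_def pol_def g_part_def)
qed

text \<open>By injectivity of \<open>left_inv\<close>, \<open>u\<close> is the combination of the
  \<open>coord_dir x k\<close> whose coefficients are the coordinates of its field at
  \<open>x\<close>; the partial derivatives therefore determine everything.\<close>

lemma pol_derivative_left_inv:
  assumes F: "F \<in> admissible br N" and D: "(pol N F has_derivative D) (at x)"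
  shows "D (left_inv mul u x) = - pol N (act F u) x"
proof -
  have lin: "linear D" using D by (rule has_derivative_linear)
  have D_axis: "D (axis k 1) = - pol N (act F (coord_dir x k)) x" for k
  proof -
    have "((\<lambda>t. x + t *\<^sub>R axis k 1) has_vector_derivative axis k 1) (at 0)"
      by (auto intro!: derivative_eq_intros)
    from vector_derivative_diff_chain_within[OF this, of "pol N F" D]
    have "((\<lambda>t. pol N F (x + t *\<^sub>R axis k 1)) has_vector_derivative D (axis k 1)) (at 0)"
      using has_derivative_at_withinI[OF D] by (simp add: o_def)
    then show ?thesis
      using pol_partial_derivative[OF F] vector_derivative_unique_at by metis
  qed
  define h where "h = left_inv mul u x"
  have u: "u = (\<Sum>k\<in>UNIV. (h $ k) *\<^sub>R coord_dir x k)"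
    using coord_dir_expand[of h x] left_inv_inj unfolding h_def by metis
  have "D h = D (\<Sum>k\<in>UNIV. (h $ k) *\<^sub>R axis k 1)"
    by (simp add: basis_expansion scalar_mult_eq_scaleR[symmetric])
  also have "\<dots> = - (\<Sum>k\<in>UNIV. (h $ k) *\<^sub>R pol N (act F (coord_dir x k)) x)"
    by (simp add: linear_sum[OF lin] linear_scale[OF lin] D_axis sum_negf)
  also have "\<dots> = - pol N (act F u) x"
    by (simp add: u linear_sum[OF linear_pol_act[OF F]] linear_scale[OF linear_pol_act[OF F]])
  finally show ?thesis by (simp add: h_def)
qed

lemma pol_along_curve:
  assumes F: "F \<in> admissible br N"
    and c: "(c has_vector_derivative left_inv mul u (c t)) (at t within S)"
  shows "((\<lambda>t. pol N F (c t)) has_vector_derivative - pol N (act F u) (c t)) (at t within S)"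
proof -
  obtain D where D: "(pol N F has_derivative D) (at (c t))"
    using pol_differentiable[of N F "c t"] by (auto simp: differentiable_def)
  show ?thesis
    using vector_derivative_diff_chain_within[OF c has_derivative_at_withinI[OF D]]
    by (simp add: o_def pol_derivative_left_inv[OF F D])
qed

lemma pol_lipschitz:
  "compact K \<Longrightarrow> L-lipschitz_on K c \<Longrightarrow> \<exists>L. L-lipschitz_on K (\<lambda>t. pol N F (c t))"
  unfolding pol_def g_part_def
  by (rule tower_prod_lipschitz[where H = "\<lambda>_. F"]) (auto intro: lipschitz_on_constant)

lemma pol_embed_Adi:
  assumes "\<And>z. embed br z \<in> admissible br N"
  shows "pol N (embed br (Adi x z)) x = z"
  using tower_prod_embed[OF assms, of js x z] by (simp add: pol_def coords g_part_embed)

text \<open>In finite dimension a one-sided inverse of a linear endomorphism is two-sided.\<close>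

lemma Adi_pol_embed:
  assumes "\<And>z. embed br z \<in> admissible br N"
  shows "Adi x (pol N (embed br z) x) = z"
proof -
  have "linear (\<lambda>z. pol N (embed br z) x)"
    using linear_compose[OF linear_embed[OF linear_br(2)] linear_pol] by (simp add: o_def)
  moreover have "(\<lambda>z. pol N (embed br z) x) \<circ> Adi x = id"
    using pol_embed_Adi[OF assms] by (simp add: fun_eq_iff)
  ultimately have "Adi x \<circ> (\<lambda>z. pol N (embed br z) x) = id"
    using linear_inverse_left linear_Adi by blast
  then show ?thesis by (simp add: fun_eq_iff)
qed

lemma coord_dir_invariant:
  assumes "linear p" "\<And>y z. p (br y z) = 0"
  shows "p (coord_dir x k) = (p (Y k) :: real)"
  unfolding coord_dir_def by (rule Adi_gprod_invariant[OF assms])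

end

section \<open>Prolongations and adapted bases\<close>

lemma linear_g_part: "linear g_part"
  by (intro linearI) (simp_all add: g_part_def scaleR_fun_apply)

lemma linear_act: "linear (\<lambda>F. act F Y)"
  by (intro linearI) (simp_all add: act_def fun_eq_iff scaleR_fun_apply)

locale stratified =
  fixes br :: "'g::euclidean_space \<Rightarrow> 'g \<Rightarrow> 'g" and V :: "int \<Rightarrow> 'g set" and s :: int
  assumes strat: "stratified_lie_algebra br V s"
begin

lemma lie: "lie_algebra br"
  using strat by (simp add: stratified_lie_algebra_def)

lemma linear_br: "linear (\<lambda>y. br x y)" "linear (\<lambda>x. br x y)"
  using lie by (simp_all add: lie_algebra_def)

lemmas antisym = lie_algebra_antisym[OF lie]

lemma br_br: "br x (br y z) = br (br x y) z - br (br x z) y"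
proof -
  have "br x (br y z) + br y (br z x) + br z (br x y) = 0"
    using lie by (simp add: lie_algebra_def)
  moreover have "br y (br z x) = br (br x z) y"
    using antisym[of y "br z x"] antisym[of z x] linear_neg[OF linear_br(2)] by simp
  moreover have "br z (br x y) = - br (br x y) z"
    by (rule antisym)
  ultimately show ?thesis
    by (simp add: eq_diff_eq add_eq_0_iff)
qed

lemma s_ge_1: "s \<ge> 1"
  using strat by (simp add: stratified_lie_algebra_def)

lemma subspace_V: "i \<ge> 1 \<Longrightarrow> subspace (V i)"
  using strat by (simp add: stratified_lie_algebra_def)

lemma V_above: "i > s \<Longrightarrow> V i = {0}"
  using strat unfolding stratified_lie_algebra_def by blast

lemma V_gen: "i \<ge> 2 \<Longrightarrow> V i = span {br x y |x y. x \<in> V (i - 1) \<and> y \<in> V 1}"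
  using strat by (simp add: stratified_lie_algebra_def)

lemma decomposition:
  "\<exists>!f. (\<forall>i\<in>{1..s}. f i \<in> V i) \<and> (\<forall>i. i \<notin> {1..s} \<longrightarrow> f i = 0) \<and> x = (\<Sum>i=1..s. f i)"
  using strat by (simp add: stratified_lie_algebra_def)

lemma decompose:
  obtains f where "\<And>i. i \<in> {1..s} \<Longrightarrow> f i \<in> V i" "x = (\<Sum>i=1..s. f i)"
  using decomposition[of x] by blast

text \<open>Only brackets with \<open>V 1\<close> are given. The Jacobi identity rewrites a bracket
  with \<open>br u w\<close> through brackets whose right entry has lower degree.\<close>

lemma V_bracket:
  assumes "i \<ge> 1" "j \<ge> 1" "x \<in> V i" "y \<in> V j"
  shows "br x y \<in> V (i + j)"
  using assms(2,1,3,4)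
proof (induction j arbitrary: i x y rule: int_ge_induct)
  case base
  then show ?case
    using V_gen[of "i + 1"] by (auto intro: span_base)
next
  case (step j)
  have "y \<in> span {br u w |u w. u \<in> V j \<and> w \<in> V 1}"
    using V_gen[of "j + 1"] step by simp
  then show ?case
  proof (induction y rule: span_induct)
    case base
    show ?case
      unfolding mem_Collect_eq
      using linear_subspace_vimage[OF linear_br(1) subspace_V, of "i + (j + 1)" x] step
      by (simp add: vimage_def)
  next
    case uw': (step y)
    then obtain u w where uw: "y = br u w" "u \<in> V j" "w \<in> V 1" by blast
    have "br x u \<in> V (i + j)"
      using step.IH[of i x u] step uw by simp
    then have "br (br x u) w \<in> {br x y |x y. x \<in> V (i + j) \<and> y \<in> V 1}"
      using uw(3) by blast
    then have "br (br x u) w \<in> V (i + (j + 1))"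
      using V_gen[of "i + (j + 1)"] step.hyps step.prems(1) by (simp add: span_base)
    moreover have "br x w \<in> V (i + 1)"
      using V_gen[of "i + 1"] step uw by (auto intro: span_base)
    then have "br (br x w) u \<in> V (i + (j + 1))"
      using step.IH[of "i + 1" "br x w" u] step uw by (simp add: algebra_simps)
    ultimately show ?case
      using subspace_V[of "i + (j + 1)"] step by (simp add: uw br_br subspace_diff)
  qed
qed

text \<open>The descending filtration by degree: a bracket with an arbitrary vector raises the
  degree but mixes the layers above.\<close>

definition upper :: "int \<Rightarrow> 'g set" where
  "upper k = span (\<Union>i\<in>{k..}. V i)"

lemma upper_above: "k > s \<Longrightarrow> x \<in> upper k \<Longrightarrow> x = 0"
  using span_mono[of "\<Union>i\<in>{k..}. V i" "{0}"] V_above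
  by (fastforce simp: upper_def)

lemma upper_bracket:
  assumes "k \<ge> 1" "x \<in> upper k"
  shows "br x y \<in> upper (k + 1)"
  using assms(2) unfolding upper_def
proof (induction x rule: span_induct)
  case base
  show ?case
    unfolding mem_Collect_eq
    using linear_subspace_vimage[OF linear_br(2) subspace_span, of y] by (simp add: vimage_def)
next
  case (step x)
  then obtain i where i: "i \<ge> k" "x \<in> V i" by auto
  obtain f where f: "\<And>i. i \<in> {1..s} \<Longrightarrow> f i \<in> V i" "y = (\<Sum>i=1..s. f i)"
    by (rule decompose) blast
  have "br x (f j) \<in> (\<Union>i\<in>{k+1..}. V i)" if "j \<in> {1..s}" for j
    using V_bracket[of i j x "f j"] f(1)[OF that] i that assms(1)
    by (intro UN_I[of "i + j"]) auto
  then show ?case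
    unfolding f(2) linear_sum[OF linear_br(1)] by (intro span_sum span_base)
qed

lemma upper_foldl: "k \<ge> 1 \<Longrightarrow> x \<in> upper k \<Longrightarrow> foldl br x Ys \<in> upper (k + int (length Ys))"
proof (induction Ys arbitrary: x k)
  case (Cons Y Ys)
  from Cons.IH[of "k + 1", OF _ upper_bracket[OF Cons.prems]] Cons.prems show ?case
    by (simp add: algebra_simps)
qed simp

lemma linear_embed_br: "linear (embed br)"
  by (rule linear_embed[OF linear_br(2)])

lemma embed_admissible_V:
  assumes "k \<ge> 1" "x \<in> V k" "s - k < int N"
  shows "embed br x \<in> admissible br N"
  unfolding admissible_def mem_Collect_eq embed_def
proof (intro conjI allI impI)
  fix Ys :: "'g list" assume "N \<le> length Ys"
  moreover have "x \<in> upper k"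
    using assms(2) unfolding upper_def by (auto intro: span_base)
  ultimately show "foldl br x Ys = 0"
    using upper_foldl[OF assms(1), of x Ys] upper_above assms(3) by force
next
  fix As Zs
  have "linear (\<lambda>Y. foldl br (br (foldl br x As) Y) Zs)"
    using linear_compose[OF linear_br(1) linear_foldl[of br, OF linear_br(2)]] by (simp add: o_def)
  then show "linear (\<lambda>Y. foldl br x (As @ Y # Zs))" by simp
next
  fix As P Q Zs
  show "foldl br x (As @ br P Q # Zs) = foldl br x (As @ P # Q # Zs) - foldl br x (As @ Q # P # Zs)"
    by (simp add: br_br linear_diff[OF linear_foldl[of br, OF linear_br(2)]])
qed

text \<open>Splitting off the leading letter: conditions at later positions are those of
  \<open>act F Y\<close>, and at the front they are linearity and the derivation rule.\<close>

lemma admissible_actI: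
  assumes N: "N > 0" and lin: "linear (act F)" and act: "\<And>Y. act F Y \<in> admissible br (N - 1)"
    and br: "\<And>X Y. act F (br X Y) = act (act F X) Y - act (act F Y) X"
  shows "F \<in> admissible br N"
  unfolding admissible_def mem_Collect_eq
proof (intro conjI allI impI)
  fix Ys :: "'g list" assume "N \<le> length Ys"
  then show "F Ys = 0"
    using N admissible_zero[OF act, of "tl Ys"] by (cases Ys) (auto simp: act_def)
next
  fix As Zs
  show "linear (\<lambda>Y. F (As @ Y # Zs))"
  proof (cases As)
    case Nil
    then show ?thesis
      using linear_add[OF lin] linear_scale[OF lin]
      by (intro linearI) (simp_all add: act_def fun_eq_iff scaleR_fun_apply)
  next
    case (Cons A As')
    then show ?thesis
      using admissible_linear[OF act[of A], of As' Zs] by (simp add: act_def)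
  qed
next
  fix As P Q Zs
  show "F (As @ br P Q # Zs) = F (As @ P # Q # Zs) - F (As @ Q # P # Zs)"
  proof (cases As)
    case Nil
    then show ?thesis using br[of P Q] by (simp add: act_def fun_eq_iff)
  next
    case (Cons A As')
    then show ?thesis
      using admissible_bracket[OF act[of A], of As' P Q Zs] by (simp add: act_def)
  qed
qed

text \<open>This is the source of \<open>N\<close>. Letters have components of degree at least 1 and
  nothing lives above degree \<open>s\<close>, so nonzero values occur only on words of length at
  most \<open>s - k\<close>.\<close>

lemma stratum_admissible:
  assumes "stratum br V k F" "s - k < int N"
  shows "F \<in> admissible br N"
  using assms
proof (induction arbitrary: N rule: stratum.induct)
  case (pos k X)
  then show ?case by (intro embed_admissible_V)
next
  case (neg k F)
  have N: "N > 0" using neg.prems neg.hyps(1) s_ge_1 by simp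
  show ?case
  proof (rule admissible_actI)
    fix Y
    obtain f where f: "\<And>i. i \<in> {1..s} \<Longrightarrow> f i \<in> V i" "Y = (\<Sum>i=1..s. f i)"
      by (rule decompose) blast
    have "act F (f i) \<in> admissible br (N - 1)" if i: "i \<in> {1..s}" for i
    proof -
      have "s - (i + k) < int (N - 1)" using i N neg.prems by simp
      then show ?thesis
        using neg.IH i f(1)[OF i] by auto
    qed
    then show "act F Y \<in> admissible br (N - 1)"
      unfolding f(2) linear_sum[OF neg.hyps(3)] by (intro subspace_sum subspace_admissible)
  qed (use neg N in auto)
qed

lemma embed_admissible:
  assumes "s \<le> int N"
  shows "embed br x \<in> admissible br N"
proof -
  obtain f where f: "\<And>i. i \<in> {1..s} \<Longrightarrow> f i \<in> V i" "x = (\<Sum>i=1..s. f i)"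
    by (rule decompose) blast
  show ?thesis
    unfolding f(2) linear_sum[OF linear_embed_br]
    by (intro subspace_sum subspace_admissible embed_admissible_V) (use f(1) assms in auto)
qed

lemma stratum_act:
  assumes "stratum br V k F" "i \<ge> 1" "x \<in> V i"
  shows "stratum br V (k + i) (act F x)"
  using assms(1)
proof cases
  case (pos X)
  then show ?thesis
    using V_bracket[of k i X x] assms by (auto simp: act_embed intro: stratum.pos)
next
  case neg
  then show ?thesis using assms by (simp add: add.commute)
qed

text \<open>Keeps iterated brackets of basis elements in the span of the basis, where their
  coordinates are meaningful.\<close>

lemma prolongation_act:
  assumes "F \<in> prolongation br V"
  shows "act F x \<in> prolongation br V"
  using assms unfolding prolongation_def
proof (induction F rule: span_induct)
  case base
  show ?case
    unfolding mem_Collect_eq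
    using linear_subspace_vimage[OF linear_act subspace_span, of x] by (simp add: vimage_def)
next
  case (step F)
  then obtain k where k: "stratum br V k F" by blast
  obtain f where f: "\<And>i. i \<in> {1..s} \<Longrightarrow> f i \<in> V i" "x = (\<Sum>i=1..s. f i)"
    by (rule decompose) blast
  have adm: "F \<in> admissible br (nat (s - k + 1))"
    by (rule stratum_admissible[OF k]) simp
  have "linear (act F)"
    using linear_add[OF linear_act_vec[OF adm]] linear_scale[OF linear_act_vec[OF adm]]
    by (intro linearI) (simp_all add: fun_eq_iff scaleR_fun_apply)
  then have eq: "act F x = (\<Sum>i=1..s. act F (f i))"
    unfolding f(2) by (rule linear_sum)
  show ?case
    unfolding eq using stratum_act[OF k] f(1) by (intro span_sum span_base) auto
qed

lemma stratum_prolongation: "stratum br V k F \<Longrightarrow> F \<in> prolongation br V"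
  unfolding prolongation_def by (blast intro: span_base)

end

locale adapted = stratified br V s
  for br :: "'g::euclidean_space \<Rightarrow> 'g \<Rightarrow> 'g" and V s +
  fixes n :: int and J :: "int set" and X :: "int \<Rightarrow> 'g tower" and d :: "int \<Rightarrow> int"
  assumes adapted: "adapted_basis br V n J X d" and n: "n = int DIM('g)"
begin

lemma J_sub: "{1..n} \<subseteq> J"
  and inj_X: "inj_on X J"
  and independent_X: "independent (X ` J)"
  and span_X: "span (X ` J) = prolongation br V"
  and span_X_embed: "span (X ` {1..n}) = range (embed br)"
  and stratum_X: "j \<in> J \<Longrightarrow> stratum br V (d j) (X j)"
  and d_mono: "i \<in> J \<Longrightarrow> j \<in> J \<Longrightarrow> i < j \<Longrightarrow> d i \<le> d j"
  using adapted by (auto simp: adapted_basis_def)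

definition y :: "int \<Rightarrow> 'g" where "y k = g_part (X k)"

lemma X_embed: "k \<in> {1..n} \<Longrightarrow> X k = embed br (y k)"
proof -
  assume "k \<in> {1..n}"
  then have "X k \<in> range (embed br)"
    using span_X_embed span_base[of "X k" "X ` {1..n}"] by blast
  then show ?thesis by (auto simp: y_def g_part_embed)
qed

lemma X_nonzero: "k \<in> J \<Longrightarrow> X k \<noteq> 0"
  using independent_X dependent_zero by (metis imageI)

text \<open>In degree \<le> 0 the \<open>g_part\<close> is zero, and an embedded element with zero
  \<open>g_part\<close> is 0, which independence excludes.\<close>

lemma d_y: "k \<in> {1..n} \<Longrightarrow> d k \<ge> 1 \<and> y k \<in> V (d k)"
proof -
  assume k: "k \<in> {1..n}"
  then have kJ: "k \<in> J" using J_sub by blast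
  show ?thesis
    using stratum_X[OF kJ]
  proof cases
    case (pos x)
    then show ?thesis using k by (simp add: y_def g_part_embed)
  next
    case neg
    then have "y k = 0" by (simp add: y_def)
    then have "X k = 0"
      using X_embed[OF k] linear_0[OF linear_embed_br] by metis
    then show ?thesis using X_nonzero[OF kJ] by blast
  qed
qed

text \<open>In positive degree \<open>X k\<close> would be embedded, hence a combination of the
  elements indexed by \<open>{1..n}\<close>, against independence.\<close>

lemma nonpos_index:
  assumes "k \<in> J" "k \<notin> {1..n}"
  shows "d k \<le> 0" "g_part (X k) = 0"
proof -
  have "d k \<le> 0 \<and> g_part (X k) = 0"
    using stratum_X[OF assms(1)]
  proof cases
    case (pos x)
    then have "X k \<in> span (X ` {1..n})"
      using span_X_embed by auto
    moreover have "X ` {1..n} \<subseteq> X ` J - {X k}"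
    proof
      fix b assume "b \<in> X ` {1..n}"
      then obtain i where i: "i \<in> {1..n}" "b = X i" by blast
      then have "i \<in> J" "i \<noteq> k" using assms J_sub by blast+
      then show "b \<in> X ` J - {X k}" using i inj_onD[OF inj_X, of i k] assms(1) by auto
    qed
    ultimately have "X k \<in> span (X ` J - {X k})"
      using span_mono by blast
    then show ?thesis
      using independent_X assms(1) by (auto simp: dependent_def)
  qed simp
  then show "d k \<le> 0" "g_part (X k) = 0" by auto
qed

lemma span_y: "span (y ` {1..n}) = UNIV"
proof -
  have "embed br ` span (y ` {1..n}) = span (embed br ` y ` {1..n})"
    using linear_span_image[OF linear_embed_br] by metis
  also have "embed br ` y ` {1..n} = X ` {1..n}"
    using X_embed by (force simp: image_iff)
  finally have img: "embed br ` span (y ` {1..n}) = range (embed br)"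
    by (simp add: span_X_embed)
  have "z \<in> span (y ` {1..n})" for z
  proof -
    obtain w where "w \<in> span (y ` {1..n})" "embed br z = embed br w"
      using img by (metis imageE rangeI)
    then show ?thesis by (metis g_part_embed)
  qed
  then show ?thesis by blast
qed

lemma card_y: "card (y ` {1..n}) = DIM('g)"
proof -
  have "card (y ` {1..n}) \<le> DIM('g)"
    using card_image_le[of "{1..n}" y] n by simp
  moreover have "DIM('g) \<le> card (y ` {1..n})"
    using dim_le_card[of UNIV "y ` {1..n}"] span_y by simp
  ultimately show ?thesis by simp
qed

lemma inj_y: "inj_on y {1..n}"
  using card_y n by (intro eq_card_imp_inj_on) simp_all

lemma independent_y: "independent (y ` {1..n})"
  using span_y card_y by (intro card_le_dim_spanning[of _ UNIV]) simp_all

definition crd :: "int \<Rightarrow> 'g \<Rightarrow> real" where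
  "crd k z = representation (y ` {1..n}) z (y k)"

lemma linear_crd: "linear (crd k)"
  unfolding crd_def
  by (intro linearI) (simp_all add: representation_add[OF independent_y] representation_scale[OF independent_y] span_y)

lemma crd_y: "k \<in> {1..n} \<Longrightarrow> j \<in> {1..n} \<Longrightarrow> crd k (y j) = (if k = j then 1 else 0)"
  using inj_y by (auto simp: crd_def representation_basis[OF independent_y] inj_on_def)

lemma crd_expand: "(\<Sum>k=1..n. crd k z *\<^sub>R y k) = z"
proof -
  have "z = (\<Sum>b\<in>y ` {1..n}. representation (y ` {1..n}) z b *\<^sub>R b)"
    using sum_representation_eq[OF independent_y, of z "y ` {1..n}"] span_y by simp
  then show ?thesis
    by (simp add: sum.reindex[OF inj_y] crd_def)
qed

lemma g_part_representation:
  assumes "F \<in> prolongation br V"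
  shows "g_part F = (\<Sum>k=1..n. representation (X ` J) F (X k) *\<^sub>R y k)"
proof -
  define R where "R = representation (X ` J) F"
  have fin: "finite {b. R b \<noteq> 0}" and sub: "{b. R b \<noteq> 0} \<subseteq> X ` J"
    unfolding R_def by (auto simp: finite_representation intro: representation_ne_zero)
  have "F = (\<Sum>b | R b \<noteq> 0. R b *\<^sub>R b)"
    unfolding R_def using sum_nonzero_representation_eq[OF independent_X] assms span_X by simp
  from arg_cong[OF this, of g_part] have "g_part F = (\<Sum>b | R b \<noteq> 0. R b *\<^sub>R g_part b)"
    by (simp only: linear_sum[OF linear_g_part] linear_scale[OF linear_g_part])
  also have "\<dots> = (\<Sum>b\<in>X ` {1..n} \<inter> {b. R b \<noteq> 0}. R b *\<^sub>R g_part b)"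
  proof (intro sum.mono_neutral_right fin ballI)
    fix b assume b: "b \<in> {b. R b \<noteq> 0} - X ` {1..n} \<inter> {b. R b \<noteq> 0}"
    then obtain k where "k \<in> J" "b = X k" "k \<notin> {1..n}" using sub by blast
    then show "R b *\<^sub>R g_part b = 0" using nonpos_index by simp
  qed auto
  also have "\<dots> = (\<Sum>b\<in>X ` {1..n}. R b *\<^sub>R g_part b)"
    by (intro sum.mono_neutral_left) auto
  also have "\<dots> = (\<Sum>k=1..n. R (X k) *\<^sub>R y k)"
    by (simp add: sum.reindex[OF inj_on_subset[OF inj_X J_sub]] y_def)
  finally show ?thesis by (simp add: R_def)
qed

lemma crd_sum_y: "k \<in> {1..n} \<Longrightarrow> crd k (\<Sum>j=1..n. a j *\<^sub>R y j) = a k"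
  by (simp add: linear_sum[OF linear_crd] linear_scale[OF linear_crd] crd_y if_distrib cong: if_cong)

text \<open>The coordinates paired with \<open>v\<close> see only \<open>g_part\<close>, since basis
  elements outside \<open>{1..n}\<close> have none. Structure constants in a possibly infinite basis
  thus become coordinates in the Lie algebra.\<close>

lemma representation_X:
  "F \<in> prolongation br V \<Longrightarrow> k \<in> {1..n} \<Longrightarrow> representation (X ` J) F (X k) = crd k (g_part F)"
  using g_part_representation crd_sum_y[of k "\<lambda>k. representation (X ` J) F (X k)"] by simp

text \<open>Sorting the expansion of \<open>z\<close> by degree yields a graded decomposition, which
  uniqueness identifies with \<open>z\<close> placed in degree \<open>i\<close> alone.\<close>

lemma crd_V:
  assumes z: "z \<in> V i" and i: "i \<ge> 1" and k: "k \<in> {1..n}" and dk: "d k \<noteq> i"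
  shows "crd k z = 0"
proof (cases "i \<le> s")
  case True
  define f where "f l = (\<Sum>k | k \<in> {1..n} \<and> d k = l. crd k z *\<^sub>R y k)" for l
  define g where "g l = (if l = i then z else 0)" for l
  have ds: "d k \<in> {1..s}" if "k \<in> {1..n}" for k
  proof -
    have "y k \<noteq> 0"
      using X_embed[OF that] linear_0[OF linear_embed_br] X_nonzero[of k] J_sub that by (metis subsetD)
    then show ?thesis using d_y[OF that] V_above[of "d k"] by force
  qed
  have "z = (\<Sum>l=1..s. f l)"
    unfolding f_def using ds crd_expand[of z]
    by (subst sum.group) auto
  moreover have "f l \<in> V l" if "l \<in> {1..s}" for l
    unfolding f_def using that d_y
    by (intro subspace_sum subspace_V subspace_scale) auto
  moreover have "f l = 0" if "l \<notin> {1..s}" for l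
    unfolding f_def using ds that by (intro sum.neutral) auto
  moreover have "z = (\<Sum>l=1..s. g l)"
    using True i by (simp add: g_def)
  moreover have "g l \<in> V l" if "l \<in> {1..s}" for l
    using that z subspace_V[of l] by (simp add: g_def subspace_0)
  moreover have "g l = 0" if "l \<notin> {1..s}" for l
    using that True i by (auto simp: g_def)
  ultimately have "f = g"
    using decomposition[of z] by blast
  then have "f (d k) = 0" using dk by (simp add: g_def)
  then have "0 = crd k (f (d k))" by (simp add: linear_0[OF linear_crd])
  also have "f (d k) = (\<Sum>j=1..n. (if d j = d k then crd j z else 0) *\<^sub>R y j)"
    unfolding f_def by (intro sum.mono_neutral_cong_left) auto
  also have "crd k \<dots> = crd k z"
    using k by (subst crd_sum_y) auto
  finally show ?thesis by simp
next
  case False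
  then show ?thesis using z V_above[of i] linear_0[OF linear_crd] by simp
qed

lemma V1_expand: "z \<in> V 1 \<Longrightarrow> z = (\<Sum>k | k \<in> {1..n} \<and> d k = 1. crd k z *\<^sub>R y k)"
  using crd_expand[of z] crd_V[of z 1] by (subst sum.mono_neutral_left[of "{1..n}"]) auto

lemma dim_V1: "dim (V 1) = card {k \<in> {1..n}. d k = 1}"
proof (rule dim_unique)
  show "y ` {k \<in> {1..n}. d k = 1} \<subseteq> V 1" using d_y by fastforce
  show "V 1 \<subseteq> span (y ` {k \<in> {1..n}. d k = 1})"
  proof
    fix z assume "z \<in> V 1"
    then show "z \<in> span (y ` {k \<in> {1..n}. d k = 1})"
      by (subst V1_expand) (auto intro!: span_sum span_scale intro: span_base)
  qed
  show "independent (y ` {k \<in> {1..n}. d k = 1})"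
    by (rule independent_mono[OF independent_y]) auto
  show "card (y ` {k \<in> {1..n}. d k = 1}) = card {k \<in> {1..n}. d k = 1}"
    by (intro card_image inj_on_subset[OF inj_y]) auto
qed

text \<open>On \<open>{1..n}\<close> degrees are at least 1 and nondecreasing, so degree 1 occupies
  an initial segment, whose length is the dimension of the first layer.\<close>

lemma deg_one: "{k \<in> {1..n}. d k = 1} = {1..int (dim (V 1))}"
proof -
  let ?A = "{k \<in> {1..n}. d k = 1}"
  have down: "i \<in> ?A" if "j \<in> ?A" "1 \<le> i" "i \<le> j" for i j
  proof -
    have i: "i \<in> {1..n}" and j: "j \<in> {1..n}" "d j = 1" using that by auto
    have "i \<in> J" "j \<in> J" using J_sub i j by blast+
    then have "d i \<le> d j"
      using d_mono[of i j] that(3) by (cases "i = j") simp_all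
    then show ?thesis using d_y[OF i] i j by auto
  qed
  show ?thesis
  proof (cases "?A = {}")
    case True
    then show ?thesis unfolding dim_V1 by (simp only: card.empty) simp
  next
    case False
    have fin: "finite ?A" by (rule finite_subset[of _ "{1..n}"]) auto
    define m where "m = Max ?A"
    have m: "m \<in> ?A" unfolding m_def by (rule Max_in[OF fin False])
    have "?A = {1..m}"
    proof (intro equalityI subsetI)
      fix i assume "i \<in> ?A"
      then show "i \<in> {1..m}" using Max_ge[OF fin, of i] by (simp add: m_def)
    next
      fix i assume "i \<in> {1..m}"
      then show "i \<in> ?A" using down[OF m] by simp
    qed
    moreover from this have "int (dim (V 1)) = m" using m by (simp add: dim_V1)
    ultimately show ?thesis by simp
  qed
qed

lemma crd_br:
  assumes k: "k \<in> {1..int (dim (V 1))}"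
  shows "crd k (br x z) = 0"
proof -
  have dk: "k \<in> {1..n}" "d k = 1" using k unfolding deg_one[symmetric] by auto
  obtain f where f: "\<And>i. i \<in> {1..s} \<Longrightarrow> f i \<in> V i" "x = (\<Sum>i=1..s. f i)"
    by (rule decompose) blast
  obtain g where g: "\<And>i. i \<in> {1..s} \<Longrightarrow> g i \<in> V i" "z = (\<Sum>i=1..s. g i)"
    by (rule decompose) blast
  have "crd k (br (f i) (g j)) = 0" if "i \<in> {1..s}" "j \<in> {1..s}" for i j
    using crd_V[OF V_bracket[of i j "f i" "g j"] _ dk(1)] f(1)[OF that(1)] g(1)[OF that(2)] that dk
    by auto
  then show ?thesis
    by (simp add: f(2) g(2) linear_sum[OF linear_br(1)] linear_sum[OF linear_br(2)] linear_sum[OF linear_crd])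
qed

lemma V1_basis: "z \<in> V 1 \<Longrightarrow> z = (\<Sum>k=1..int (dim (V 1)). crd k z *\<^sub>R y k)"
  using V1_expand deg_one by simp

lemma d_le_1: "k \<in> J \<Longrightarrow> k \<le> int (dim (V 1)) \<Longrightarrow> d k \<le> 1"
  using nonpos_index(1)[of k] deg_one by (cases "k \<in> {1..n}") force+

lemma rank_le: "int (dim (V 1)) \<le> n"
  using dim_subset_UNIV[of "V 1"] n by simp

end

section \<open>Abnormal extremals\<close>

lemma g_part_foldl_act: "g_part (foldl act F Ys) = F Ys"
  by (induction Ys arbitrary: F) (simp_all add: act_def g_part_def)

locale abnormal_setup = smooth_group mul iv + adapted "lie_bracket mul" V s n J X d
  for mul :: "real^'n \<Rightarrow> real^'n \<Rightarrow> real^'n" and iv V s n J X d +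
  fixes E :: "real^'n \<Rightarrow> real^'n" and ix :: "int \<Rightarrow> 'n" and r :: int
  assumes E: "exponential_map mul E"
    and ix: "bij_betw ix {1..n} UNIV"
    and coordinates: "\<And>x. x = foldr mul (map (\<lambda>k. E ((x $ ix k) *\<^sub>R g_part (X k))) (rev [1..n])) 0"
    and r: "r = int (dim (V 1))"
begin

lemma n_card: "int CARD('n) = n"
  using n by simp

definition Y :: "'n \<Rightarrow> real^'n" where
  "Y i = y (inv_into {1..n} ix i)"

lemma Y_ix: "k \<in> {1..n} \<Longrightarrow> Y (ix k) = y k"
  using ix by (simp add: Y_def bij_betw_def inv_into_f_f)

lemma sum_ix: "(\<Sum>i\<in>UNIV. f i) = (\<Sum>k=1..n. f (ix k))"
  by (rule sum.reindex_bij_betw[OF ix, symmetric])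

sublocale C: exp_coordinates mul iv E Y "map ix [1..n]"
proof
  show "exponential_map mul E" by (rule E)
  show "lie_algebra (lie_bracket mul)" by (rule lie)
  show "distinct (map ix [1..n])"
    using ix by (simp add: distinct_map bij_betw_def)
  show "set (map ix [1..n]) = UNIV"
    using ix by (simp add: bij_betw_def)
  have group: "exp_group mul iv E"
    by unfold_locales (rule E, rule lie)
  show "exp_group.gprod mul E Y (map ix [1..n]) x = x" for x
  proof -
    have "map (\<lambda>j. E ((x $ j) *\<^sub>R Y j)) (rev (map ix [1..n])) =
        map (\<lambda>k. E ((x $ ix k) *\<^sub>R g_part (X k))) (rev [1..n])"
      by (simp add: rev_map Y_ix y_def)
    then show ?thesis
      unfolding exp_group.gprod_def[OF group] using coordinates[of x] by metis
  qed
qed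

definition pairing :: "real^'n \<Rightarrow> real^'n \<Rightarrow> real" where
  "pairing v z = (\<Sum>k=1..n. crd k z * v $ ix k)"

lemma linear_pairing: "linear (pairing v)"
  unfolding pairing_def
  by (intro linearI) (simp_all add: linear_add[OF linear_crd] linear_scale[OF linear_crd]
      sum.distrib distrib_right sum_distrib_left mult.assoc)

lemma pairing_y: "k \<in> {1..n} \<Longrightarrow> pairing v (y k) = v $ ix k"
  by (simp add: pairing_def crd_y if_distrib[of "\<lambda>x. x * _"] cong: if_cong)

lemma prolongation_X: "i \<in> J \<Longrightarrow> X i \<in> prolongation (lie_bracket mul) V"
  by (rule stratum_prolongation[OF stratum_X])

lemma prolongation_foldl: "F \<in> prolongation (lie_bracket mul) V \<Longrightarrow>
    foldl act F Ys \<in> prolongation (lie_bracket mul) V"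
  by (induction Ys arbitrary: F) (simp_all add: prolongation_act)

lemma gen_structure_const_sum:
  assumes "i \<in> J"
  shows "(\<Sum>k=1..n. gen_structure_const ix J X i \<alpha> k * v $ ix k) =
    pairing v (X i (concat (map (\<lambda>j. replicate (\<alpha> j) (Y j)) (map ix [1..n]))))"
proof -
  have word: "map (\<lambda>j. replicate (\<alpha> (ix j)) (g_part (X j))) [1..n] =
      map (\<lambda>j. replicate (\<alpha> j) (Y j)) (map ix [1..n])"
    by (simp add: Y_ix y_def)
  show ?thesis
    unfolding gen_structure_const_def iterated_bracket_def pairing_def n_card word
    by (intro sum.cong refl)
      (simp only: representation_X[OF prolongation_foldl[OF prolongation_X[OF assms]]]
        g_part_foldl_act)
qed

lemma extremal_poly_eq:
  assumes i: "i \<in> J" and adm: "X i \<in> admissible (lie_bracket mul) N"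
  shows "extremal_poly ix J X i v x = pairing v (C.pol N (X i) x)"
proof -
  define w where "w \<alpha> = concat (map (\<lambda>j. replicate (\<alpha> j) (Y j)) (map ix [1..n]))" for \<alpha>
  define c where "c \<alpha> = (\<Prod>j\<in>UNIV. (- (x $ j)) ^ \<alpha> j / fact (\<alpha> j))" for \<alpha>
  define B where "B = {\<alpha>::'n \<Rightarrow> nat. \<forall>j. \<alpha> j < N}"
  have "B = (UNIV \<rightarrow>\<^sub>E {..<N})" by (auto simp: B_def PiE_def Pi_def)
  then have fin: "finite B" by (simp add: finite_PiE)
  have set: "set (map ix [1..n]) = UNIV" by (rule C.set_js)
  have len: "length (w \<alpha>) = (\<Sum>j\<in>UNIV. \<alpha> j)" for \<alpha>
    unfolding w_def
    using sum_list_distinct_conv_sum_set[OF C.distinct_js, of \<alpha>]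
    by (simp add: length_concat o_def set[simplified])
  \<comment> \<open>One exponent of size at least \<open>N\<close> already makes the word too long
    for \<open>X i\<close>; the infinite sum is supported in the finite box
    \<open>B\<close>.\<close>
  have zero: "X i (w \<alpha>) = 0" if \<alpha>: "\<alpha> \<notin> B" for \<alpha>
  proof -
    obtain j where "N \<le> \<alpha> j" using \<alpha> by (auto simp: B_def not_less)
    also have "\<alpha> j \<le> length (w \<alpha>)" unfolding len by (rule member_le_sum) auto
    finally show ?thesis by (rule admissible_zero[OF adm])
  qed
  have c: "(-1) ^ (\<Sum>j\<in>UNIV. \<alpha> j) / (\<Prod>j\<in>UNIV. fact (\<alpha> j)) * p * (\<Prod>j\<in>UNIV. (x $ j) ^ \<alpha> j) = c \<alpha> * p"
    for \<alpha> p
  proof -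
    have "c \<alpha> = (\<Prod>j\<in>UNIV. (-1) ^ \<alpha> j) * (\<Prod>j\<in>UNIV. (x $ j) ^ \<alpha> j) / (\<Prod>j\<in>UNIV. fact (\<alpha> j))"
      unfolding c_def prod_dividef prod.distrib[symmetric]
      by (simp only: power_mult_distrib[symmetric]) simp
    then show ?thesis by (simp add: power_sum)
  qed
  have "extremal_poly ix J X i v x = (\<Sum>\<^sub>\<infinity>\<alpha>. c \<alpha> * pairing v (X i (w \<alpha>)))"
    unfolding extremal_poly_def n_card gen_structure_const_sum[OF i] c w_def ..
  also have "\<dots> = (\<Sum>\<^sub>\<infinity>\<alpha>\<in>B. c \<alpha> * pairing v (X i (w \<alpha>)))"
    by (rule infsum_cong_neutral) (auto simp: zero linear_0[OF linear_pairing])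
  also have "\<dots> = pairing v (\<Sum>\<alpha>\<in>B. c \<alpha> *\<^sub>R X i (w \<alpha>))"
    by (simp add: fin linear_sum[OF linear_pairing] linear_scale[OF linear_pairing])
  also have "(\<Sum>\<alpha>\<in>B. c \<alpha> *\<^sub>R X i (w \<alpha>)) = C.pol N (X i) x"
    unfolding C.pol_def g_part_def tower_prod_expand[OF C.distinct_js] set
    by (simp add: B_def c_def w_def)
  finally show ?thesis .
qed

definition ctrl :: "(real \<Rightarrow> real^'n) \<Rightarrow> real \<Rightarrow> real^'n" where
  "ctrl \<gamma> t = (\<Sum>j=1..r. (vector_derivative \<gamma> (at t within {0..1}) $ ix j) *\<^sub>R y j)"

lemma rank_subset: "{1..r} \<subseteq> {1..n}"
  using rank_le r by simp

text \<open>The controls are the first \<open>r\<close> components of the velocity: the velocity is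
  a combination of coordinate fields, and \<open>coord_dir\<close> has the same degree 1 coordinates
  as \<open>Y\<close>, because brackets have none.\<close>

lemma horizontal_derivative:
  assumes "horizontal_curve mul X r \<gamma>"
  shows "AE t in lebesgue_on {0..1}. t \<in> {0..1} \<and>
    (\<gamma> has_vector_derivative left_inv mul (ctrl \<gamma> t) (\<gamma> t)) (at t within {0..1})"
proof -
  obtain h where h: "AE t in lebesgue_on {0..1}.
      (\<gamma> has_vector_derivative (\<Sum>j=1..r. h j t *\<^sub>R left_inv mul (g_part (X j)) (\<gamma> t))) (at t within {0..1})"
    using assms by (auto simp: horizontal_curve_def)
  \<comment> \<open>Membership in the interval is recorded because uniqueness of the one-sided or
    two-sided derivative at \<open>t\<close> depends on it.\<close>
  have "AE t in lebesgue_on {0..1}. t \<in> {0..1::real}"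
  proof -
    have "{t \<in> {0..1}. t \<notin> {0..1::real}} = {}" by blast
    then show ?thesis
      using AE_lebesgue_on_iff_negligible[of "{0..1}" "\<lambda>t. t \<in> {0..1::real}"]
      by (simp del: atLeastAtMost_iff)
  qed
  with h show ?thesis
  proof eventually_elim
    case (elim t)
    define u where "u = (\<Sum>j=1..r. h j t *\<^sub>R y j)"
    define D where "D = vector_derivative \<gamma> (at t within {0..1})"
    have "(\<Sum>j=1..r. h j t *\<^sub>R left_inv mul (g_part (X j)) (\<gamma> t)) = left_inv mul u (\<gamma> t)"
      unfolding u_def y_def by (simp add: linear_sum[OF linear_left_inv] linear_scale[OF linear_left_inv])
    with elim have u: "(\<gamma> has_vector_derivative left_inv mul u (\<gamma> t)) (at t within {0..1})"
      by simp
    then have D: "D = left_inv mul u (\<gamma> t)"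
      unfolding D_def using vector_derivative_within_cbox[of 0 1 t \<gamma>] elim(2) by simp
    have "u = (\<Sum>i\<in>UNIV. (D $ i) *\<^sub>R C.coord_dir (\<gamma> t) i)"
      using C.coord_dir_expand[of D "\<gamma> t"] D left_inv_inj by metis
    then have "crd j u = (\<Sum>i\<in>UNIV. (D $ i) * crd j (Y i))" if "j \<in> {1..r}" for j
      using C.coord_dir_invariant[OF linear_crd crd_br] that r
      by (simp add: linear_sum[OF linear_crd] linear_scale[OF linear_crd])
    moreover have "(\<Sum>i\<in>UNIV. (D $ i) * crd j (Y i)) = D $ ix j" if "j \<in> {1..r}" for j
      using that rank_subset unfolding sum_ix
      by (simp add: Y_ix crd_y subset_iff if_distrib[of "\<lambda>x. _ * x"] cong: if_cong)
    moreover have "crd j u = h j t" if "j \<in> {1..r}" for j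
      using that rank_subset unfolding u_def
      by (simp add: linear_sum[OF linear_crd] linear_scale[OF linear_crd] crd_y subset_iff
          if_distrib[of "\<lambda>x. _ * x"] cong: if_cong)
    ultimately have "u = ctrl \<gamma> t"
      unfolding u_def ctrl_def D_def[symmetric] by (intro sum.cong) auto
    then show ?case using u elim by simp
  qed
qed

lemma structure_const_eq:
  assumes "i \<in> {1..n}" "j \<in> {1..n}" "k \<in> {1..n}"
  shows "structure_const J X i j k = crd k (lie_bracket mul (y i) (y j))"
proof -
  have "act (X i) (y j) = embed (lie_bracket mul) (lie_bracket mul (y i) (y j))"
    using X_embed[OF assms(1)] by (simp add: act_embed)
  moreover have "act (X i) (y j) \<in> prolongation (lie_bracket mul) V"
    using assms(1) J_sub by (intro prolongation_act prolongation_X) auto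
  ultimately show ?thesis
    using representation_X[of "act (X i) (y j)" k] assms(3)
    by (simp add: structure_const_def y_def[symmetric] g_part_embed)
qed

lemma ode_rhs:
  assumes "i \<in> {1..n}"
  shows "(\<Sum>k=1..n. \<Sum>j=1..r. structure_const J X i j k *
      (vector_derivative \<gamma> (at t within {0..1}) $ ix j) * l k) =
    (\<Sum>k=1..n. crd k (lie_bracket mul (y i) (ctrl \<gamma> t)) * l k)"
proof (intro sum.cong refl)
  fix k assume k: "k \<in> {1..n}"
  have "structure_const J X i j k = crd k (lie_bracket mul (y i) (y j))" if "j \<in> {1..r}" for j
    using structure_const_eq[OF assms _ k] that rank_subset by blast
  then show "(\<Sum>j=1..r. structure_const J X i j k *
      (vector_derivative \<gamma> (at t within {0..1}) $ ix j) * l k) =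
    crd k (lie_bracket mul (y i) (ctrl \<gamma> t)) * l k"
    by (simp add: ctrl_def linear_sum[OF linear_br(1)] linear_scale[OF linear_br(1)]
        linear_sum[OF linear_crd] linear_scale[OF linear_crd] sum_distrib_left sum_distrib_right mult_ac)
qed

lemma embed_adm: "embed (lie_bracket mul) z \<in> admissible (lie_bracket mul) (nat s)"
  by (rule embed_admissible) simp

lemma pairing_has_real_derivative:
  assumes "(f has_vector_derivative f') F"
  shows "((\<lambda>t. pairing v (f t)) has_real_derivative pairing v f') F"
  using bounded_linear.has_vector_derivative[OF linear_pairing[THEN linear_conv_bounded_linear[THEN iffD1]] assms]
  by (simp add: has_real_derivative_iff_has_vector_derivative)

lemma abnormalI:
  assumes hor: "horizontal_curve mul X r \<gamma>" and v: "v \<noteq> 0"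
    and zero: "\<And>t i. t \<in> {0..1} \<Longrightarrow> i \<in> {1..r} \<Longrightarrow> extremal_poly ix J X i v (\<gamma> t) = 0"
  shows "abnormal_extremal mul ix J X r \<gamma>"
proof -
  define P where "P z t = pairing v (C.pol (nat s) (embed (lie_bracket mul) z) (\<gamma> t))" for z t
  define l where "l i = P (y i)" for i
  have linP: "linear (\<lambda>z. P z t)" for t
    using linear_compose[OF linear_compose[OF linear_embed_br C.linear_pol] linear_pairing]
    by (simp add: P_def o_def)
  have P_expand: "P z t = (\<Sum>k=1..n. crd k z * l k t)" for z t
    by (subst crd_expand[of z, symmetric])
      (simp only: l_def linear_sum[OF linP] linear_scale[OF linP] real_scaleR_def)
  obtain L where L: "L-lipschitz_on {0..1} \<gamma>"
    using hor by (auto simp: horizontal_curve_def)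
  have lip: "\<exists>L. L-lipschitz_on {0..1} (l i)" for i
  proof -
    obtain M where M: "M-lipschitz_on {0..1} (\<lambda>t. C.pol (nat s) (embed (lie_bracket mul) (y i)) (\<gamma> t))"
      using C.pol_lipschitz[OF _ L] by auto
    obtain B where "B-lipschitz_on UNIV (pairing v)"
      using bounded_linear.lipschitz_boundE[OF linear_pairing[THEN linear_conv_bounded_linear[THEN iffD1]]]
      by blast
    from lipschitz_on_compose2[OF M lipschitz_on_subset[OF this subset_UNIV]] show ?thesis
      unfolding l_def P_def by blast
  qed
  \<comment> \<open>The adjoint action of \<open>\<gamma> t\<close> is onto, so a dual vector
    vanishing at time \<open>t\<close> would force \<open>v = 0\<close>.\<close>
  have nonzero: "\<exists>i\<in>{1..n}. l i t \<noteq> 0" for t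
  proof (rule ccontr)
    assume "\<not> ?thesis"
    then have "P z t = 0" for z by (simp add: P_expand)
    then have "pairing v z = 0" for z
      using C.pol_embed_Adi[OF embed_adm] unfolding P_def by metis
    then have "v $ ix k = 0" if "k \<in> {1..n}" for k
      using pairing_y[OF that] by metis
    moreover have "\<exists>k\<in>{1..n}. i = ix k" for i
      using ix by (metis UNIV_I bij_betw_def imageE)
    ultimately have "v $ i = 0" for i by metis
    then show False using v by (simp add: vec_eq_iff)
  qed
  have vanish: "l i t = 0" if "i \<in> {1..r}" "t \<in> {0..1}" for i t
  proof -
    have i: "i \<in> {1..n}" using that rank_subset by blast
    then show ?thesis
      using zero[OF that(2,1)] extremal_poly_eq[of i "nat s" v "\<gamma> t"] X_embed[OF i] J_sub embed_adm
      by (auto simp: l_def P_def)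
  qed
  have ode: "AE t in lebesgue_on {0..1}. (l i has_real_derivative
      - (\<Sum>k=1..n. \<Sum>j=1..r. structure_const J X i j k *
        (vector_derivative \<gamma> (at t within {0..1}) $ ix j) * l k t)) (at t within {0..1})"
    if i: "i \<in> {1..n}" for i
    using horizontal_derivative[OF hor]
  proof eventually_elim
    case (elim t)
    from pairing_has_real_derivative[OF C.pol_along_curve[OF embed_adm conjunct2[OF elim]]]
    show ?case
      unfolding ode_rhs[OF i] P_expand[symmetric]
      by (simp add: l_def P_def[abs_def] act_embed linear_neg[OF linear_pairing])
  qed
  show ?thesis
    unfolding abnormal_extremal_def n_card
    using hor lip nonzero vanish ode by (intro conjI exI[of _ l] ballI) auto
qed

lemma extremal_poly_vanishes:
  assumes hor: "horizontal_curve mul X r \<gamma>" and \<gamma>0: "\<gamma> 0 = 0"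
    and zero: "\<And>t i. t \<in> {0..1} \<Longrightarrow> i \<in> {1..r} \<Longrightarrow> extremal_poly ix J X i v (\<gamma> t) = 0"
    and i: "i \<in> J" "i \<le> r" and t: "t \<in> {0..1}"
  shows "extremal_poly ix J X i v (\<gamma> t) = 0"
proof -
  \<comment> \<open>One cut-off serves all degrees from \<open>d i\<close> up to 1, the range of the
    descending induction.\<close>
  define N where "N = nat (s - d i + 1)"
  have di: "d i \<le> 1" using d_le_1 i r by simp
  have adm: "F \<in> admissible (lie_bracket mul) N" if "stratum (lie_bracket mul) V k F" "d i \<le> k" for k F
    using stratum_admissible[OF that(1), of N] that(2) s_ge_1 di by (simp add: N_def)
  obtain L where L: "L-lipschitz_on {0..1} \<gamma>"
    using hor by (auto simp: horizontal_curve_def)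
  \<comment> \<open>The claim covers whole strata, because the bracket of a basis element with the
    control need not be a basis element.\<close>
  have "\<forall>F. \<forall>t::real. d i \<le> k \<longrightarrow> stratum (lie_bracket mul) V k F \<longrightarrow> t \<in> {0..1} \<longrightarrow>
      pairing v (C.pol N F (\<gamma> t)) = 0" if "k \<le> 1" for k
    using that
  proof (induction k rule: int_le_induct)
    case base
    show ?case
    proof (intro allI impI)
      fix F and t :: real assume st: "stratum (lie_bracket mul) V 1 F" and t: "t \<in> {0..1}"
      from st obtain z where z: "F = embed (lie_bracket mul) z" "z \<in> V 1"
        by cases auto
      have N: "s \<le> int N" using s_ge_1 di by (simp add: N_def)
      have X0: "pairing v (C.pol N (embed (lie_bracket mul) (y k)) (\<gamma> t)) = 0" if "k \<in> {1..r}" for k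
      proof -
        have k: "k \<in> {1..n}" using that rank_subset by blast
        then show ?thesis
          using zero[OF t that] extremal_poly_eq[of k N v "\<gamma> t"] X_embed[OF k] J_sub
            embed_admissible[OF N] by auto
      qed
      have lin: "linear (\<lambda>z. pairing v (C.pol N (embed (lie_bracket mul) z) (\<gamma> t)))"
        using linear_compose[OF linear_compose[OF linear_embed_br C.linear_pol] linear_pairing]
        by (simp add: o_def)
      have z_eq: "z = (\<Sum>k=1..r. crd k z *\<^sub>R y k)"
        using V1_basis[OF z(2)] r by simp
      show "pairing v (C.pol N F (\<gamma> t)) = 0"
        unfolding z(1) by (subst z_eq) (simp add: linear_sum[OF lin] linear_scale[OF lin] X0)
    qed
  next
    case (step k)
    show ?case
    proof (intro allI impI)
      fix F and t :: real assume k: "d i \<le> k - 1" and st: "stratum (lie_bracket mul) V (k - 1) F" and t: "t \<in> {0..1}"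
      have F: "F \<in> admissible (lie_bracket mul) N" by (rule adm[OF st k])
      have g0: "g_part F = 0" using st step.hyps by cases auto
      have "AE t in lebesgue_on {0..1}.
          ((\<lambda>t. pairing v (C.pol N F (\<gamma> t))) has_real_derivative 0) (at t within {0..1})"
        using horizontal_derivative[OF hor]
      proof eventually_elim
        case (elim t)
        \<comment> \<open>The control lies in the first layer, so bracketing with it raises the
          degree by exactly one and reaches the induction hypothesis.\<close>
        have "y j \<in> V 1" if "j \<in> {1..r}" for j
          using that d_y[of j] deg_one r rank_subset by force
        then have "ctrl \<gamma> t \<in> V 1"
          unfolding ctrl_def by (intro subspace_sum subspace_V subspace_scale) auto
        from stratum_act[OF st _ this]
        have "pairing v (C.pol N (act F (ctrl \<gamma> t)) (\<gamma> t)) = 0"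
          using step.IH k elim by auto
        then show ?case
          using pairing_has_real_derivative[OF C.pol_along_curve[OF F conjunct2[OF elim]], of v]
          by (simp add: linear_neg[OF linear_pairing])
      qed
      moreover have "(\<lambda>x. pairing v (C.pol N F x)) differentiable (at x)" for x
        by (rule differentiable_compose[OF _ C.pol_differentiable])
          (simp add: linear_imp_differentiable linear_pairing)
      ultimately have "pairing v (C.pol N F (\<gamma> t)) = pairing v (C.pol N F (\<gamma> 0))"
        using constant_along_lipschitz_curve[OF L, of "\<lambda>x. pairing v (C.pol N F x)" t] t by simp
      also have "\<dots> = 0"
        by (simp add: \<gamma>0 C.pol_0[OF F] g0 linear_0[OF linear_pairing])
      finally show "pairing v (C.pol N F (\<gamma> t)) = 0" .
    qed
  qed
  then have "pairing v (C.pol N (X i) (\<gamma> t)) = 0"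
    using di stratum_X[OF i(1)] t by blast
  then show ?thesis
    using extremal_poly_eq[OF i(1) adm[OF stratum_X[OF i(1)]]] by simp
qed

text \<open>The dual curve is transported by the coadjoint action: \<open>\<lambda>(t) \<circ> Ad(\<gamma>(t))\<^sup>-\<^sup>1\<close> is constant.\<close>

lemma abnormalD:
  assumes abn: "abnormal_extremal mul ix J X r \<gamma>" and \<gamma>0: "\<gamma> 0 = 0"
  obtains v where "v \<noteq> 0"
    "\<And>t i. t \<in> {0..1} \<Longrightarrow> i \<in> {1..r} \<Longrightarrow> extremal_poly ix J X i v (\<gamma> t) = 0"
proof -
  have hor: "horizontal_curve mul X r \<gamma>" using abn by (simp add: abnormal_extremal_def)
  obtain l where lip: "\<And>i. i \<in> {1..n} \<Longrightarrow> \<exists>L. L-lipschitz_on {0..1} (l i)"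
    and nonzero: "\<And>t. t \<in> {0..1} \<Longrightarrow> \<exists>i\<in>{1..n}. l i t \<noteq> 0"
    and vanish: "\<And>i t. i \<in> {1..r} \<Longrightarrow> t \<in> {0..1} \<Longrightarrow> l i t = 0"
    and ode: "\<And>i. i \<in> {1..n} \<Longrightarrow> AE t in lebesgue_on {0..1}. (l i has_real_derivative
      - (\<Sum>k=1..n. \<Sum>j=1..r. structure_const J X i j k *
        (vector_derivative \<gamma> (at t within {0..1}) $ ix j) * l k t)) (at t within {0..1})"
    using abn unfolding abnormal_extremal_def n_card by blast
  define \<Lambda> where "\<Lambda> t = (\<chi> i. l (inv_into {1..n} ix i) t)" for t
  have \<Lambda>: "\<Lambda> t $ ix k = l k t" if "k \<in> {1..n}" for k t
    using ix that by (simp add: \<Lambda>_def bij_betw_def inv_into_f_f)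
  have pairing_\<Lambda>: "pairing (\<Lambda> t) z = (\<Sum>k=1..n. crd k z * l k t)" for t z
    unfolding pairing_def by (intro sum.cong refl) (simp add: \<Lambda>)
  \<comment> \<open>The conserved quantity depends on both point and covector; on the joint curve it
    is a differentiable function \<open>G\<close> of a Lipschitz curve.\<close>
  define \<Gamma> where "\<Gamma> t = (\<gamma> t, \<Lambda> t)" for t
  obtain L where L: "L-lipschitz_on {0..1} \<gamma>"
    using hor by (auto simp: horizontal_curve_def)
  have "\<exists>M. M-lipschitz_on {0..1} \<Lambda>"
  proof -
    have "\<Lambda> t = (\<Sum>i\<in>UNIV. \<Lambda> t $ i *\<^sub>R axis i 1)" for t
      by (simp add: basis_expansion scalar_mult_eq_scaleR[symmetric])
    then have eq: "\<Lambda> t = (\<Sum>k=1..n. l k t *\<^sub>R axis (ix k) 1)" for t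
      by (simp add: sum_ix \<Lambda>)
    show ?thesis
      unfolding eq[abs_def]
      by (intro lipschitz_on_sum_ex lipschitz_on_scaleR_compact lip) (auto intro: lipschitz_on_constant)
  qed
  then obtain M where M: "M-lipschitz_on {0..1} \<Lambda>" by blast
  have \<Gamma>: "(sqrt (L\<^sup>2 + M\<^sup>2))-lipschitz_on {0..1} \<Gamma>"
    unfolding \<Gamma>_def[abs_def] by (rule lipschitz_on_Pair[OF L M])
  have const: "pairing (\<Lambda> t) (Adi (\<gamma> t) w) = pairing (\<Lambda> 0) w" if t: "t \<in> {0..1}" for t :: real and w
  proof -
    define G where "G = (\<lambda>(x, m). \<Sum>k=1..n. crd k (Adi x w) * m $ ix k)"
    have GP: "G (\<Gamma> t) = pairing (\<Lambda> t) (Adi (\<gamma> t) w)" for t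
      by (simp add: G_def \<Gamma>_def pairing_def)
    have "(\<lambda>z. crd k (Adi (fst z) w)) differentiable (at z)" for k and z :: "(real^'n) \<times> (real^'n)"
      by (rule differentiable_compose[of "crd k" "\<lambda>z. Adi (fst z) w"],
          simp add: linear_imp_differentiable linear_crd,
          rule differentiable_compose[of "\<lambda>x. Adi x w" fst], rule Adi_differentiable,
          simp add: linear_imp_differentiable linear_fst)
    moreover have "(\<lambda>z. snd z $ ix k) differentiable (at z)" for k and z :: "(real^'n) \<times> (real^'n)"
      by (intro bounded_linear_imp_differentiable bounded_linear_compose[OF bounded_linear_vec_nth] bounded_linear_snd)
    ultimately have Gd: "G differentiable (at z)" for z
      unfolding G_def case_prod_beta by (intro differentiable_sum differentiable_mult finite_atLeastAtMost_int ballI) auto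
    have all: "AE t in lebesgue_on {0..1}. \<forall>i\<in>{1..n}. (l i has_real_derivative
      - (\<Sum>k=1..n. \<Sum>j=1..r. structure_const J X i j k *
        (vector_derivative \<gamma> (at t within {0..1}) $ ix j) * l k t)) (at t within {0..1})"
      by (rule AE_finite_allI[OF _ ode]) auto
    have "AE t in lebesgue_on {0..1}. ((\<lambda>t. G (\<Gamma> t)) has_real_derivative 0) (at t within {0..1})"
      using horizontal_derivative[OF hor] all
    proof eventually_elim
      case (elim t)
      let ?A = "Adi (\<gamma> t) w"
      have 1: "((\<lambda>t. crd k (Adi (\<gamma> t) w)) has_real_derivative
          crd k (- lie_bracket mul (ctrl \<gamma> t) ?A)) (at t within {0..1})" for k
        using bounded_linear.has_vector_derivative[OF linear_crd[THEN linear_conv_bounded_linear[THEN iffD1]]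
          Adi_along_curve[OF conjunct2[OF elim(1)]]]
        by (simp add: has_real_derivative_iff_has_vector_derivative)
      have 2: "(l k has_real_derivative - pairing (\<Lambda> t) (lie_bracket mul (y k) (ctrl \<gamma> t))) (at t within {0..1})"
        if "k \<in> {1..n}" for k
        using elim(2) that by (simp add: ode_rhs pairing_\<Lambda>)
      have "((\<lambda>t. \<Sum>k=1..n. crd k (Adi (\<gamma> t) w) * l k t) has_real_derivative
        (\<Sum>k=1..n. crd k (- lie_bracket mul (ctrl \<gamma> t) ?A) * l k t +
           - pairing (\<Lambda> t) (lie_bracket mul (y k) (ctrl \<gamma> t)) * crd k ?A)) (at t within {0..1})"
        by (intro DERIV_sum DERIV_mult 1 2)
      \<comment> \<open>With \<open>u\<close> the control, the two halves are the pairings with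
        \<open>- br u ?A\<close> and \<open>- br ?A u\<close>, which cancel by antisymmetry.\<close>
      moreover have "(\<Sum>k=1..n. crd k (- lie_bracket mul (ctrl \<gamma> t) ?A) * l k t +
           - pairing (\<Lambda> t) (lie_bracket mul (y k) (ctrl \<gamma> t)) * crd k ?A) = 0"
      proof -
        have "(\<Sum>k=1..n. pairing (\<Lambda> t) (lie_bracket mul (y k) (ctrl \<gamma> t)) * crd k ?A) =
            pairing (\<Lambda> t) (lie_bracket mul (\<Sum>k=1..n. crd k ?A *\<^sub>R y k) (ctrl \<gamma> t))"
          by (simp add: linear_sum[OF linear_br(2)] linear_scale[OF linear_br(2)]
              linear_sum[OF linear_pairing] linear_scale[OF linear_pairing] mult.commute)
        also have "\<dots> = pairing (\<Lambda> t) (- lie_bracket mul (ctrl \<gamma> t) ?A)"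
          unfolding crd_expand by (metis antisym)
        finally show ?thesis
          by (simp add: sum_subtractf pairing_\<Lambda>[symmetric])
      qed
      ultimately show ?case
        by (simp add: GP pairing_\<Lambda>)
    qed
    from constant_along_lipschitz_curve[OF \<Gamma> Gd this t] show ?thesis
      by (simp add: GP \<gamma>0)
  qed
  show ?thesis
  proof (rule that)
    show "\<Lambda> 0 \<noteq> 0"
    proof
      assume "\<Lambda> 0 = 0"
      then have "l k 0 = 0" if "k \<in> {1..n}" for k
        using \<Lambda>[OF that, of 0] by simp
      then show False using nonzero[of 0] by auto
    qed
  next
    fix t i assume t: "t \<in> {0..1::real}" and i: "i \<in> {1..r}"
    then have i': "i \<in> {1..n}" using rank_subset by blast
    have "extremal_poly ix J X i (\<Lambda> 0) (\<gamma> t) =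
        pairing (\<Lambda> 0) (C.pol (nat s) (embed (lie_bracket mul) (y i)) (\<gamma> t))"
      using extremal_poly_eq[of i "nat s"] X_embed[OF i'] J_sub i' embed_adm by auto
    \<comment> \<open>In \<open>const\<close>, \<open>w\<close> is the image of \<open>y i\<close>
      under the adjoint action of \<open>\<gamma> t\<close>, which \<open>Adi\<close>
      undoes.\<close>
    also have "\<dots> = pairing (\<Lambda> t) (y i)"
      using const[OF t] C.Adi_pol_embed[OF embed_adm] by metis
    also have "\<dots> = 0"
      using i i' t by (simp add: pairing_y \<Lambda> vanish)
    finally show "extremal_poly ix J X i (\<Lambda> 0) (\<gamma> t) = 0" .
  qed
qed

end

theorem theorem1p2:
  fixes mul :: "real^'n \<Rightarrow> real^'n \<Rightarrow> real^'n"
    and V :: "int \<Rightarrow> (real^'n) set" and s r :: int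
    and ix :: "int \<Rightarrow> 'n"
    and J :: "int set" and X :: "int \<Rightarrow> (real^'n) tower" and d :: "int \<Rightarrow> int"
    and \<gamma> :: "real \<Rightarrow> real^'n"
  assumes "lie_group mul"
    and "stratified_lie_algebra (lie_bracket mul) V s"
    and "r = int (dim (V 1))"
    and "bij_betw ix {1..int CARD('n)} UNIV"
    and "adapted_basis (lie_bracket mul) V (int CARD('n)) J X d"
    and "second_type_coordinates mul ix X"
    and "horizontal_curve mul X r \<gamma>" and "\<gamma> 0 = 0"
  shows "abnormal_extremal mul ix J X r \<gamma> \<longleftrightarrow>
    (\<exists>v::real^'n. v \<noteq> 0 \<and>
       (\<forall>t\<in>{0..1}. \<forall>i\<in>J. i \<le> r \<longrightarrow> extremal_poly ix J X i v (\<gamma> t) = 0))"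
proof -
  obtain iv where iv: "group mul 0 iv" "smooth iv" and smooth: "smooth (\<lambda>(x, y). mul x y)"
    using assms(1) by (auto simp: lie_group_def)
  obtain E where E: "exponential_map mul E" and coords:
    "\<And>x. x = foldr mul (map (\<lambda>k. E ((x $ ix k) *\<^sub>R g_part (X k))) (rev [1..int CARD('n)])) 0"
    using assms(6) unfolding second_type_coordinates_def by blast
  interpret abnormal_setup mul iv V s "int CARD('n)" J X d E ix r
    by (intro abnormal_setup.intro smooth_group.intro adapted.intro stratified.intro
        adapted_axioms.intro abnormal_setup_axioms.intro smooth iv E assms coords) simp
  show ?thesis
  proof
    assume "abnormal_extremal mul ix J X r \<gamma>"
    \<comment> \<open>The dual curve settles the indices in \<open>{1..r}\<close>; constancy along
      the curve extends the same \<open>v\<close> to all of \<open>J\<close> up to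
      \<open>r\<close>.\<close>
    from abnormalD[OF this assms(8)] obtain v where "v \<noteq> 0"
      and v: "\<And>t i. t \<in> {0..1} \<Longrightarrow> i \<in> {1..r} \<Longrightarrow> extremal_poly ix J X i v (\<gamma> t) = 0"
      by blast
    then show "\<exists>v::real^'n. v \<noteq> 0 \<and>
       (\<forall>t\<in>{0..1}. \<forall>i\<in>J. i \<le> r \<longrightarrow> extremal_poly ix J X i v (\<gamma> t) = 0)"
      using extremal_poly_vanishes[OF assms(7,8) v] by blast
  next
    assume "\<exists>v::real^'n. v \<noteq> 0 \<and>
       (\<forall>t\<in>{0..1}. \<forall>i\<in>J. i \<le> r \<longrightarrow> extremal_poly ix J X i v (\<gamma> t) = 0)"
    then obtain v :: "real^'n" where "v \<noteq> 0"
      "\<And>t i. t \<in> {0..1} \<Longrightarrow> i \<in> {1..r} \<Longrightarrow> extremal_poly ix J X i v (\<gamma> t) = 0"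
      using J_sub rank_subset by (metis atLeastAtMost_iff subset_iff)
    then show "abnormal_extremal mul ix J X r \<gamma>"
      by (intro abnormalI[OF assms(7)])
  qed
qed

end
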